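(* Let $E$ be a separable Banach space, $f:\Omega\times E\to\overline{\mathbb{R}}$ a normal integrand, $x_0\in L_\infty(\Omega,E)$ with $I_f(x_0)$ finite. A function $x^*\in L_1(\Omega,E^*_{\sigma^*})$ is a Fréchet subderivative of $I_f$ at $x_0$ on $L_\infty(\Omega,E)$ if and only if there exists a family $(u_r)_{r>0}$ of functions, non negative and integrable for $r$ small enough, such that $\lim_{r\to0_+}\|u_r\|_1=0$ and for all sufficiently small $r>0$ $$\inf_{\|e\|\le1}[f-\langle x^*,\cdot\rangle](x_0,e,r)\ \ge\ -u_r\quad\text{a.e.}$$
   Context: $(\Omega,\mathbb{T},\mu)$ is a measure space with $\mu$ a $\sigma$-finite positive measure and $\mathbb{T}$ $\mu$-complete. A normal integrand is a $\mathbb{T}\otimes\mathcal{B}(E)$-measurable function $f:\Omega\times E\to\overline{\mathbb{R}}$ such that $f(\omega,\cdot)$ is (norm) lower semicontinuous for every $\omega$. $I_f(x)=\int^*_\Omega f(\omega,x(\omega))\,d\mu(\omega)$ with $\int^*_\Omega v\,d\mu=\inf\{\int_\Omega u\,d\mu: u\in L_1(\Omega,\mathbb{R}),\ u\ge v\text{ a.e.}\}$. $L_1(\Omega,E^*_{\sigma^*})$ is the set of classes of scalarly measurable $x^*:\Omega\to E^*$ with $\|x^*\|_*\in L_1(\Omega,\mathbb{R})$, acting on $L_\infty(\Omega,E)$ by $\langle x^*,x\rangle=\int_\Omega\langle x^*(\omega),x(\omega)\rangle\,d\mu$. $[f-\langle x^*,\cdot\rangle](x_0,e,r)$ is the function $\omega\mapsto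 r^{-1}(f(\omega,x_0(\omega)+re)-f(\omega,x_0(\omega)))-\langle x^*(\omega),e\rangle$. For a functional $J$ on a normed space finite at $x_0$, $x^*$ is a Fréchet subderivative of $J$ at $x_0$ if $\liminf_{x\to x_0}\frac{J(x)-J(x_0)-\langle x^*,x-x_0\rangle}{\|x-x_0\|}\ge0$. *)

theory Defs
  imports "HOL-Analysis.Analysis" "HOL-Probability.Essential_Supremum"
begin

definition lower_semicontinuous :: "('a::topological_space \<Rightarrow> ereal) \<Rightarrow> bool" where
  "lower_semicontinuous g \<longleftrightarrow> (\<forall>x. g x \<le> Liminf (at x) g)"

definition normal_integrand ::
    "'w measure \<Rightarrow> ('w \<Rightarrow> 'e::{banach, second_countable_topology} \<Rightarrow> ereal) \<Rightarrow> bool" where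
  "normal_integrand M f \<longleftrightarrow>
     (\<lambda>(\<omega>, x). f \<omega> x) \<in> borel_measurable (M \<Otimes>\<^sub>M borel) \<and>
     (\<forall>\<omega>\<in>space M. lower_semicontinuous (f \<omega>))"

definition upper_integral :: "'w measure \<Rightarrow> ('w \<Rightarrow> ereal) \<Rightarrow> ereal" where
  "upper_integral M v =
     (INF u \<in> {u :: 'w \<Rightarrow> real. integrable M u \<and> (AE \<omega> in M. v \<omega> \<le> ereal (u \<omega>))}.
        ereal (\<integral>\<omega>. u \<omega> \<partial>M))"

definition integral_functional ::
    "'w measure \<Rightarrow> ('w \<Rightarrow> 'e \<Rightarrow> ereal) \<Rightarrow> ('w \<Rightarrow> 'e) \<Rightarrow> ereal" where
  "integral_functional M f x = upper_integral M (\<lambda>\<omega>. f \<omega> (x \<omega>))"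

text \<open>
  The spaces \<open>L\<^sub>\<infinity>(\<Omega>, E)\<close> and \<open>L\<^sub>1(\<Omega>, E\<^sup>*)\<close> are represented by their functions rather than by classes
  modulo a.e. equality, so \<open>Linf_norm\<close> is only a seminorm. As \<open>E\<close> is separable, strong
  and Borel measurability coincide.
\<close>

definition Linf ::
    "'w measure \<Rightarrow> ('w \<Rightarrow> 'e::{banach, second_countable_topology}) set" where
  "Linf M = {x \<in> borel_measurable M. esssup M (\<lambda>\<omega>. ereal (norm (x \<omega>))) < \<infinity>}"

text \<open>
  On a null measure the essential supremum is \<open>-\<infinity>\<close>, which \<^const>\<open>real_of_ereal\<close> maps to the
  correct norm \<open>0\<close>.
\<close>

definition Linf_norm ::
    "'w measure \<Rightarrow> ('w \<Rightarrow> 'e::{banach, second_countable_topology}) \<Rightarrow> real" where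
  "Linf_norm M x = real_of_ereal (esssup M (\<lambda>\<omega>. ereal (norm (x \<omega>))))"

definition L1_dual :: "'w measure \<Rightarrow> ('w \<Rightarrow> ('e::real_normed_vector \<Rightarrow>\<^sub>L real)) set" where
  "L1_dual M = {xs. (\<forall>e. (\<lambda>\<omega>. blinfun_apply (xs \<omega>) e) \<in> borel_measurable M) \<and>
                    integrable M (\<lambda>\<omega>. norm (xs \<omega>))}"

definition pairing ::
    "'w measure \<Rightarrow> ('w \<Rightarrow> ('e::real_normed_vector \<Rightarrow>\<^sub>L real)) \<Rightarrow> ('w \<Rightarrow> 'e) \<Rightarrow> real" where
  "pairing M xs x = (\<integral>\<omega>. blinfun_apply (xs \<omega>) (x \<omega>) \<partial>M)"

text \<open>
  \<open>X\<close> is the carrier of a (semi)normed space with (semi)norm \<open>N\<close>. The filter \<open>punctured_at X N x0\<close> is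
  that of the punctured neighbourhoods \<open>{x \<in> X. 0 < N (x - x0) < \<delta>}\<close> of \<open>x0\<close>.
\<close>

definition punctured_at :: "'v::minus set \<Rightarrow> ('v \<Rightarrow> real) \<Rightarrow> 'v \<Rightarrow> 'v filter" where
  "punctured_at X N x0 = inf (filtercomap (\<lambda>x. N (x - x0)) (at_right 0)) (principal X)"

definition frechet_subderivative ::
    "'v::minus set \<Rightarrow> ('v \<Rightarrow> real) \<Rightarrow> ('v \<Rightarrow> ereal) \<Rightarrow> ('v \<Rightarrow> real) \<Rightarrow> 'v \<Rightarrow> bool" where
  "frechet_subderivative X N J L x0 \<longleftrightarrow>
     \<bar>J x0\<bar> \<noteq> \<infinity> \<and>
     Liminf (punctured_at X N x0)
       (\<lambda>x. (J x - J x0 - ereal (L (x - x0))) / ereal (N (x - x0))) \<ge> 0"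

text \<open>
  When \<open>f \<omega> (x0 \<omega>)\<close> is infinite the difference quotient takes a junk value; if the integral
  functional is finite at \<open>x0\<close> this happens only on a null set.
\<close>

definition reduced_quotient ::
    "('w \<Rightarrow> 'e \<Rightarrow> ereal) \<Rightarrow> ('w \<Rightarrow> ('e::real_normed_vector \<Rightarrow>\<^sub>L real)) \<Rightarrow> ('w \<Rightarrow> 'e) \<Rightarrow>
     'e \<Rightarrow> real \<Rightarrow> 'w \<Rightarrow> ereal" where
  "reduced_quotient f xs x0 e r \<omega> =
     ereal (inverse r) * (f \<omega> (x0 \<omega> + r *\<^sub>R e) - f \<omega> (x0 \<omega>)) - ereal (blinfun_apply (xs \<omega>) e)"

end

theory Submission
  imports Defs
begin

text \<open>
  The value of the integral functional at \<open>x0\<close> is finite, hence \<open>\<omega> \<mapsto> f(\<omega>, x0(\<omega>))\<close> is almost everywhere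
  equal to an integrable real function. A lower bound \<open>-u r\<close> for the difference quotients over
  the unit ball then integrates to a lower bound for the increments of the functional at distance \<open>r\<close>
  from \<open>x0\<close>, with error \<open>r\<close> times the norm of \<open>u r\<close>, and this is the subderivative inequality
  (\<open>frechet_subderivative_if_quotient_bound\<close>).

  For the converse, \<open>u r\<close> should be the supremum over the unit ball of the negative part of the
  quotient. The subderivative inequality, applied to \<open>x0 + r y\<close> with \<open>y\<close> a measurable function cut off to
  the points where the quotient is negative, bounds the integral of this negative part along every
  measurable \<open>y\<close> by one and the same \<open>\<epsilon>\<close>, as soon as \<open>r\<close> is small
  (\<open>nn_integral_quotient_deficit_le\<close>). It remains to pass from measurable functions \<open>y\<close>
  to all vectors \<open>e\<close> simultaneously, that is, to interchange the integral with a supremum over an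
  uncountable set (\<open>nn_integral_sup_selections\<close>). Maximizing the integral gives a countable
  supremum \<open>U\<close> that no measurable selection exceeds on a set of positive measure, and the question
  is whether the set of points \<open>\<omega>\<close> for which some \<open>e\<close> exceeds \<open>U(\<omega>)\<close> is null.

  It is, by the selection theorem \<open>null_projection\<close>: a product-measurable set that every
  measurable function avoids almost everywhere has a null projection. The proof of this goes through
  the Souslin operation. A product-measurable set is obtained by that operation from rectangles with
  closed second factor (\<open>souslin_measurable\<close>); if its projection has
  positive outer measure, the sequences indexing the Souslin operation may be bounded termwise without
  losing all of the measure, and over the finitely branching tree that remains a branch, and with it a
  point of the section, can be chosen measurably (\<open>measurable_branch_selection\<close>).
\<close>

section \<open>Souslin representations of product-measurable sets\<close>

definition finitely_determined :: "((nat \<Rightarrow> nat) \<Rightarrow> 'a) \<Rightarrow> bool" where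
  "finitely_determined G \<longleftrightarrow> (\<exists>n. \<forall>\<sigma> \<tau>. (\<forall>i<n. \<sigma> i = \<tau> i) \<longrightarrow> G \<sigma> = G \<tau>)"

lemma finitely_determined_const: "finitely_determined (\<lambda>_. c)"
  by (auto simp: finitely_determined_def)

lemma finitely_determined_coordinate: "finitely_determined (\<lambda>\<sigma>. G (\<sigma> i))"
  by (auto simp: finitely_determined_def intro!: exI[of _ "Suc i"])

lemma finitely_determined_reindex:
  assumes "finitely_determined G"
  shows "finitely_determined (\<lambda>\<sigma>. G (\<lambda>j. \<sigma> (p j)))"
proof -
  obtain n where n: "\<And>\<sigma> \<tau>. (\<forall>i<n. \<sigma> i = \<tau> i) \<Longrightarrow> G \<sigma> = G \<tau>"
    using assms unfolding finitely_determined_def by blast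
  have "G (\<lambda>j. \<sigma> (p j)) = G (\<lambda>j. \<tau> (p j))" if "\<forall>i<Suc (Max (p ` {..<n})). \<sigma> i = \<tau> i" for \<sigma> \<tau>
  proof (rule n, intro allI impI)
    fix i assume "i < n"
    then have "p i \<le> Max (p ` {..<n})"
      by auto
    then show "\<sigma> (p i) = \<tau> (p i)"
      using that by auto
  qed
  then show ?thesis
    unfolding finitely_determined_def by blast
qed

lemma finitely_determined_combine:
  assumes "finitely_determined G" "finitely_determined H"
  shows "finitely_determined (\<lambda>\<sigma>. h (G \<sigma>) (H \<sigma>))"
proof -
  obtain m n where
    "\<And>\<sigma> \<tau>. (\<forall>i<m. \<sigma> i = \<tau> i) \<Longrightarrow> G \<sigma> = G \<tau>"
    "\<And>\<sigma> \<tau>. (\<forall>i<n. \<sigma> i = \<tau> i) \<Longrightarrow> H \<sigma> = H \<tau>"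
    using assms unfolding finitely_determined_def by metis
  then have "\<forall>\<sigma> \<tau>. (\<forall>i<max m n. \<sigma> i = \<tau> i) \<longrightarrow> h (G \<sigma>) (H \<sigma>) = h (G \<tau>) (H \<tau>)"
    by (metis less_max_iff_disj)
  then show ?thesis
    unfolding finitely_determined_def by blast
qed

text \<open>
  Instead of indexing by finite sequences, as is usual for the Souslin operation, the sets are indexed
  by \<open>n\<close> and an infinite sequence \<open>\<sigma>\<close> of which only finitely many terms matter. How many may depend on
  \<open>n\<close> in any way, so that schemes can be reindexed freely; this is what makes countable intersections
  easy below.
\<close>

definition souslin_scheme ::
    "'w measure \<Rightarrow> (nat \<Rightarrow> (nat \<Rightarrow> nat) \<Rightarrow> 'w set) \<Rightarrow> (nat \<Rightarrow> (nat \<Rightarrow> nat) \<Rightarrow> 'e::topological_space set) \<Rightarrow>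
      ('w \<times> 'e) set \<Rightarrow> bool" where
  "souslin_scheme M B F A \<longleftrightarrow>
     (\<forall>n. finitely_determined (B n)) \<and> (\<forall>n. finitely_determined (F n)) \<and>
     (\<forall>n \<sigma>. B n \<sigma> \<in> sets M) \<and> (\<forall>n \<sigma>. closed (F n \<sigma>)) \<and>
     (\<forall>\<omega> e. (\<omega>, e) \<in> A \<longleftrightarrow> \<omega> \<in> space M \<and> (\<exists>\<sigma>. \<forall>n. \<omega> \<in> B n \<sigma> \<and> e \<in> F n \<sigma>))"

lemma souslin_schemeD:
  assumes "souslin_scheme M B F A"
  shows "finitely_determined (B n)" "finitely_determined (F n)" "B n \<sigma> \<in> sets M" "closed (F n \<sigma>)"
    "(\<omega>, e) \<in> A \<longleftrightarrow> \<omega> \<in> space M \<and> (\<exists>\<sigma>. \<forall>n. \<omega> \<in> B n \<sigma> \<and> e \<in> F n \<sigma>)"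
  using assms by (simp_all add: souslin_scheme_def)

definition souslin :: "'w measure \<Rightarrow> ('w \<times> 'e::topological_space) set \<Rightarrow> bool" where
  "souslin M A \<longleftrightarrow> (\<exists>B F. souslin_scheme M B F A)"

lemma souslinI:
  fixes B :: "nat \<Rightarrow> (nat \<Rightarrow> nat) \<Rightarrow> 'w set"
    and F :: "nat \<Rightarrow> (nat \<Rightarrow> nat) \<Rightarrow> 'e::topological_space set"
  assumes "\<And>n. finitely_determined (B n)" "\<And>n. finitely_determined (F n)"
    and "\<And>n \<sigma>. B n \<sigma> \<in> sets M" "\<And>n \<sigma>. closed (F n \<sigma>)"
    and "\<And>\<omega> e. (\<omega>, e) \<in> A \<longleftrightarrow> \<omega> \<in> space M \<and> (\<exists>\<sigma>. \<forall>n. \<omega> \<in> B n \<sigma> \<and> e \<in> F n \<sigma>)"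
  shows "souslin M A"
  unfolding souslin_def souslin_scheme_def using assms by (intro exI[of _ B] exI[of _ F]) simp

lemma souslin_rectangle:
  assumes "B \<in> sets M" "closed F"
  shows "souslin M (B \<times> F)"
  using assms sets.sets_into_space[OF assms(1)]
  by (intro souslinI[of "\<lambda>_ _. B" "\<lambda>_ _. F"]) (auto simp: finitely_determined_const)

text \<open>
  The first term of \<open>\<sigma>\<close> selects the member of the family, the remaining terms are a sequence for that
  member. All the other members impose the trivial condition.
\<close>

lemma souslin_UN:
  fixes A :: "nat \<Rightarrow> ('w \<times> 'e::topological_space) set"
  assumes "\<And>i. souslin M (A i)"
  shows "souslin M (\<Union>i. A i)"
proof -
  obtain B F where BF: "\<And>i. souslin_scheme M (B i) (F i) (A i)"
    using assms unfolding souslin_def by metis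
  note dB = souslin_schemeD(1)[OF BF] and dF = souslin_schemeD(2)[OF BF]
    and mB = souslin_schemeD(3)[OF BF] and cF = souslin_schemeD(4)[OF BF]
    and A = souslin_schemeD(5)[OF BF]
  define B' where "B' k \<sigma> = (case prod_decode k of (i, n) \<Rightarrow>
      if \<sigma> 0 = i then B i n (\<lambda>j. \<sigma> (Suc j)) else space M)" for k \<sigma>
  define F' where "F' k \<sigma> = (case prod_decode k of (i, n) \<Rightarrow>
      if \<sigma> 0 = i then F i n (\<lambda>j. \<sigma> (Suc j)) else UNIV)" for k \<sigma>
  have "finitely_determined (B' k)" for k
    unfolding B'_def
    using finitely_determined_combine[OF finitely_determined_coordinate[of "\<lambda>x. x" 0]
        finitely_determined_reindex[OF dB], of "\<lambda>a b. if a = fst (prod_decode k) then b else space M"]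
    by (simp add: case_prod_beta)
  moreover have "finitely_determined (F' k)" for k
    unfolding F'_def
    using finitely_determined_combine[OF finitely_determined_coordinate[of "\<lambda>x. x" 0]
        finitely_determined_reindex[OF dF], of "\<lambda>a b. if a = fst (prod_decode k) then b else UNIV"]
    by (simp add: case_prod_beta)
  moreover have "B' k \<sigma> \<in> sets M" "closed (F' k \<sigma>)" for k \<sigma>
    by (auto simp: B'_def F'_def mB cF split: prod.split)
  moreover have "(\<omega>, e) \<in> (\<Union>i. A i) \<longleftrightarrow> \<omega> \<in> space M \<and> (\<exists>\<sigma>. \<forall>k. \<omega> \<in> B' k \<sigma> \<and> e \<in> F' k \<sigma>)"
    for \<omega> e
  proof -
    have "(\<exists>i \<sigma>. \<forall>n. \<omega> \<in> B i n \<sigma> \<and> e \<in> F i n \<sigma>) \<longleftrightarrow> (\<exists>\<sigma>. \<forall>k. \<omega> \<in> B' k \<sigma> \<and> e \<in> F' k \<sigma>)"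
      if w: "\<omega> \<in> space M"
    proof
      assume "\<exists>i \<sigma>. \<forall>n. \<omega> \<in> B i n \<sigma> \<and> e \<in> F i n \<sigma>"
      then obtain i \<sigma> where "\<And>n. \<omega> \<in> B i n \<sigma> \<and> e \<in> F i n \<sigma>"
        by blast
      then have "\<forall>k. \<omega> \<in> B' k (case_nat i \<sigma>) \<and> e \<in> F' k (case_nat i \<sigma>)"
        using w by (auto simp: B'_def F'_def split: prod.split)
      then show "\<exists>\<sigma>. \<forall>k. \<omega> \<in> B' k \<sigma> \<and> e \<in> F' k \<sigma>"
        by blast
    next
      assume "\<exists>\<sigma>. \<forall>k. \<omega> \<in> B' k \<sigma> \<and> e \<in> F' k \<sigma>"
      then obtain \<sigma> where s: "\<And>k. \<omega> \<in> B' k \<sigma> \<and> e \<in> F' k \<sigma>"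
        by blast
      have "\<omega> \<in> B (\<sigma> 0) n (\<lambda>j. \<sigma> (Suc j)) \<and> e \<in> F (\<sigma> 0) n (\<lambda>j. \<sigma> (Suc j))" for n
        using s[of "prod_encode (\<sigma> 0, n)"] by (simp add: B'_def F'_def)
      then show "\<exists>i \<sigma>. \<forall>n. \<omega> \<in> B i n \<sigma> \<and> e \<in> F i n \<sigma>"
        by blast
    qed
    then show ?thesis
      by (simp add: A) blast
  qed
  ultimately show ?thesis
    by (intro souslinI[of B' F'])
qed

text \<open>
  A single sequence on \<open>\<nat> \<times> \<nat> \<cong> \<nat>\<close> carries one sequence for each member of the family.
\<close>

lemma souslin_INT:
  fixes A :: "nat \<Rightarrow> ('w \<times> 'e::topological_space) set"
  assumes "\<And>i. souslin M (A i)"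
  shows "souslin M (\<Inter>i. A i)"
proof -
  obtain B F where BF: "\<And>i. souslin_scheme M (B i) (F i) (A i)"
    using assms unfolding souslin_def by metis
  note dB = souslin_schemeD(1)[OF BF] and dF = souslin_schemeD(2)[OF BF]
    and mB = souslin_schemeD(3)[OF BF] and cF = souslin_schemeD(4)[OF BF]
    and A = souslin_schemeD(5)[OF BF]
  define B' where "B' k \<sigma> = (case prod_decode k of (i, n) \<Rightarrow> B i n (\<lambda>j. \<sigma> (prod_encode (i, j))))" for k \<sigma>
  define F' where "F' k \<sigma> = (case prod_decode k of (i, n) \<Rightarrow> F i n (\<lambda>j. \<sigma> (prod_encode (i, j))))" for k \<sigma>
  have "finitely_determined (B' k)" "finitely_determined (F' k)" for k
    unfolding B'_def F'_def
    using finitely_determined_reindex[OF dB] finitely_determined_reindex[OF dF]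
    by (simp_all add: case_prod_beta)
  moreover have "B' k \<sigma> \<in> sets M" "closed (F' k \<sigma>)" for k \<sigma>
    by (auto simp: B'_def F'_def mB cF split: prod.split)
  moreover have "(\<omega>, e) \<in> (\<Inter>i. A i) \<longleftrightarrow> \<omega> \<in> space M \<and> (\<exists>\<sigma>. \<forall>k. \<omega> \<in> B' k \<sigma> \<and> e \<in> F' k \<sigma>)"
    for \<omega> e
  proof -
    have "(\<forall>i. \<exists>\<sigma>. \<forall>n. \<omega> \<in> B i n \<sigma> \<and> e \<in> F i n \<sigma>) \<longleftrightarrow> (\<exists>\<sigma>. \<forall>k. \<omega> \<in> B' k \<sigma> \<and> e \<in> F' k \<sigma>)"
    proof
      assume "\<forall>i. \<exists>\<sigma>. \<forall>n. \<omega> \<in> B i n \<sigma> \<and> e \<in> F i n \<sigma>"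
      then obtain \<sigma> where "\<And>i n. \<omega> \<in> B i n (\<sigma> i) \<and> e \<in> F i n (\<sigma> i)"
        by metis
      then have "\<forall>k. \<omega> \<in> B' k (\<lambda>l. case prod_decode l of (i, j) \<Rightarrow> \<sigma> i j) \<and>
          e \<in> F' k (\<lambda>l. case prod_decode l of (i, j) \<Rightarrow> \<sigma> i j)"
        by (auto simp: B'_def F'_def split: prod.split)
      then show "\<exists>\<sigma>. \<forall>k. \<omega> \<in> B' k \<sigma> \<and> e \<in> F' k \<sigma>"
        by blast
    next
      assume "\<exists>\<sigma>. \<forall>k. \<omega> \<in> B' k \<sigma> \<and> e \<in> F' k \<sigma>"
      then obtain \<sigma> where s: "\<And>k. \<omega> \<in> B' k \<sigma> \<and> e \<in> F' k \<sigma>"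
        by blast
      have "\<omega> \<in> B i n (\<lambda>j. \<sigma> (prod_encode (i, j))) \<and> e \<in> F i n (\<lambda>j. \<sigma> (prod_encode (i, j)))" for i n
        using s[of "prod_encode (i, n)"] by (simp add: B'_def F'_def)
      then show "\<forall>i. \<exists>\<sigma>. \<forall>n. \<omega> \<in> B i n \<sigma> \<and> e \<in> F i n \<sigma>"
        by blast
    qed
    then show ?thesis
      by (simp add: A)
  qed
  ultimately show ?thesis
    by (intro souslinI[of B' F'])
qed

lemma souslin_open_strip:
  fixes U :: "'e::metric_space set"
  assumes "open U"
  shows "souslin M (space M \<times> U)"
proof -
  define F where "F n = (\<Inter>y\<in>-U. {x. 1 / real (Suc n) \<le> dist x y})" for n
  have "closed (F n)" for n
    unfolding F_def by (intro closed_INT ballI closed_Collect_le continuous_intros)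
  moreover have "U = (\<Union>n. F n)"
  proof (intro equalityI subsetI)
    fix x assume "x \<in> U"
    then obtain r where "r > 0" "ball x r \<subseteq> U"
      using assms open_contains_ball by blast
    moreover obtain n where "1 / real (Suc n) < r"
      using \<open>r > 0\<close> nat_approx_posE by blast
    ultimately have "x \<in> F n"
      by (auto simp: F_def subset_eq)
    then show "x \<in> (\<Union>n. F n)"
      by blast
  next
    fix x assume "x \<in> (\<Union>n. F n)"
    then obtain n where "\<And>y. y \<notin> U \<Longrightarrow> 1 / real (Suc n) \<le> dist x y"
      by (auto simp: F_def)
    from this[of x] show "x \<in> U"
      by (cases "x \<in> U") simp_all
  qed
  moreover have "space M \<times> (\<Union>n. F n) = (\<Union>n. space M \<times> F n)"
    by auto
  ultimately show ?thesis
    using souslin_UN[of M "\<lambda>n. space M \<times> F n"] souslin_rectangle[of "space M" M "F _"]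
    by simp
qed

text \<open>
  The sets that are Souslin together with their complement form a \<open>\<sigma>\<close>-algebra, and it contains the
  rectangles because an open set of a metric space is a countable union of closed ones.
\<close>

lemma souslin_measurable:
  fixes A :: "('w \<times> 'e::metric_space) set"
  assumes "A \<in> sets (M \<Otimes>\<^sub>M borel)"
  shows "souslin M A"
proof -
  define C where "C = {A :: ('w \<times> 'e) set. A \<subseteq> space M \<times> UNIV \<and> souslin M A \<and> souslin M (space M \<times> UNIV - A)}"
  have CI: "A \<in> C" if "A \<subseteq> space M \<times> UNIV" "souslin M A" "souslin M (space M \<times> UNIV - A)" for A
    using that by (simp add: C_def)
  have UN: "(\<Union>i. A i) \<in> C" if "\<And>i. A i \<in> C" for A :: "nat \<Rightarrow> _"
  proof -
    have "space M \<times> UNIV - (\<Union>i. A i) = (\<Inter>i. space M \<times> UNIV - A i)"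
      by auto
    then show ?thesis
      using that souslin_UN[of M A] souslin_INT[of M "\<lambda>i. space M \<times> UNIV - A i"]
      by (simp add: C_def UN_least)
  qed
  have compl: "space M \<times> UNIV - A \<in> C" if "A \<in> C" for A
    using that by (intro CI) (simp_all add: C_def double_diff)
  have empty: "{} \<in> C"
    using souslin_rectangle[of "{}" M UNIV] souslin_rectangle[of "space M" M UNIV]
    by (intro CI) simp_all
  have "C \<subseteq> Pow (space M \<times> UNIV)"
    by (auto simp: C_def)
  then have alg: "sigma_algebra (space M \<times> UNIV) C"
    unfolding sigma_algebra_iff2 using UN compl empty by (simp add: image_subset_iff)
  interpret C: sigma_algebra "space M \<times> UNIV" C
    by (rule alg)
  have base: "B \<times> UNIV \<in> C" if "B \<in> sets M" for B
  proof -
    have "space M \<times> UNIV - B \<times> UNIV = (space M - B) \<times> (UNIV :: 'e set)"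
      by auto
    then show ?thesis
      using that souslin_rectangle[of B M UNIV] souslin_rectangle[of "space M - B" M UNIV]
        sets.sets_into_space[OF that]
      by (intro CI Sigma_mono) (simp_all add: sets.compl_sets)
  qed
  have strip: "space M \<times> U \<in> C" if "U \<in> sigma_sets UNIV (Collect open)" for U
    using that
  proof induction
    case (Basic U)
    have "space M \<times> UNIV - space M \<times> U = space M \<times> (-U)"
      by auto
    then show ?case
      using Basic souslin_open_strip[of U M] souslin_rectangle[of "space M" M "-U"]
      by (intro CI Sigma_mono) (simp_all add: closed_Compl)
  next
    case Empty
    show ?case using empty by simp
  next
    case (Compl U)
    have "space M \<times> (UNIV - U) = space M \<times> UNIV - space M \<times> U"
      by auto
    then show ?case
      using compl[OF Compl.IH] by simp
  next
    case (Union U)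
    have "space M \<times> (\<Union>i. U i) = (\<Union>i. space M \<times> U i)"
      by auto
    then show ?case
      using UN Union.IH by simp
  qed
  have "{a \<times> b |a b. a \<in> sets M \<and> b \<in> sets (borel :: 'e measure)} \<subseteq> C"
  proof clarify
    fix a and b :: "'e set" assume a: "a \<in> sets M" and b: "b \<in> sets borel"
    have "a \<times> b = (a \<times> UNIV) \<inter> (space M \<times> b)"
      using sets.sets_into_space[OF a] by auto
    moreover have "space M \<times> b \<in> C"
      using b strip by (simp add: borel_def)
    ultimately show "a \<times> b \<in> C"
      using base[OF a] by (simp add: C.Int)
  qed
  then have "sets (M \<Otimes>\<^sub>M borel) \<subseteq> C"
    unfolding sets_pair_measure using C.sigma_sets_subset by simp
  then show ?thesis
    using assms by (auto simp: C_def)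
qed

section \<open>Measurable selections and null projections\<close>

text \<open>
  A Souslin set over a complete space can be unfolded along a tree of measurable subsets of the base
  alone: \<open>D s\<close> collects the points \<open>\<omega>\<close> that satisfy the conditions decided by the finite sequence \<open>s\<close>
  and for which the closed sets decided by \<open>s\<close> have a common point, and \<open>c s\<close> is such a point. Since
  the closed sets are made arbitrarily small, completeness turns an infinite branch \<open>\<sigma>\<close> through \<open>\<omega>\<close>
  into a point of the section of \<open>A\<close> at \<open>\<omega>\<close>, namely the limit of the \<open>c s\<close> along the branch.
\<close>

lemma souslin_tree:
  fixes A :: "('w \<times> 'e::complete_space) set"
  assumes "souslin M A" and small: "\<exists>d :: nat \<Rightarrow> 'e. \<forall>x. \<forall>r>0. \<exists>n. dist x (d n) \<le> r"
  obtains D :: "nat list \<Rightarrow> 'w set" and c :: "nat list \<Rightarrow> 'e" where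
    "\<And>s. D s \<in> sets M" "\<And>s j. D (s @ [j]) \<subseteq> D s"
    "\<And>\<omega> e. (\<omega>, e) \<in> A \<Longrightarrow> \<exists>\<sigma>. \<forall>n. \<omega> \<in> D (map \<sigma> [0..<n])"
    "\<And>\<omega> \<sigma>. \<forall>n. \<omega> \<in> D (map \<sigma> [0..<n]) \<Longrightarrow> \<exists>e. (\<lambda>n. c (map \<sigma> [0..<n])) \<longlonglongrightarrow> e \<and> (\<omega>, e) \<in> A"
proof -
  obtain B F0 where BF: "souslin_scheme M B F0 A"
    using assms(1) unfolding souslin_def by blast
  note dB0 = souslin_schemeD(1)[OF BF] and dF0 = souslin_schemeD(2)[OF BF]
    and mB0 = souslin_schemeD(3)[OF BF] and cF0 = souslin_schemeD(4)[OF BF]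
    and A0 = souslin_schemeD(5)[OF BF]
  obtain d :: "nat \<Rightarrow> 'e" where d: "\<And>x r. r > 0 \<Longrightarrow> \<exists>n. dist x (d n) \<le> r"
    using small by blast
  \<comment> \<open>Even coordinates carry the given representation, odd coordinates the centres of balls of radius
    \<open>2\<^sup>-\<^sup>n\<close> around the point.\<close>
  define G where "G n \<sigma> = B n (\<lambda>j. \<sigma> (2 * j))" for n \<sigma>
  define F where "F n \<sigma> = F0 n (\<lambda>j. \<sigma> (2 * j)) \<inter> cball (d (\<sigma> (2 * n + 1))) ((1/2) ^ n)" for n \<sigma>
  have dG: "finitely_determined (G n)" for n
    unfolding G_def by (rule finitely_determined_reindex[OF dB0])
  have dF: "finitely_determined (F n)" for n
    unfolding F_def
    by (rule finitely_determined_combine[OF finitely_determined_reindex[OF dF0]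
          finitely_determined_coordinate[where G = "\<lambda>i. cball (d i) _"]])
  have mG: "G n \<sigma> \<in> sets M" and cF: "closed (F n \<sigma>)" for n \<sigma>
    by (auto simp: G_def F_def mB0 cF0)
  have A_iff: "(\<omega>, e) \<in> A \<longleftrightarrow> \<omega> \<in> space M \<and> (\<exists>\<sigma>. \<forall>n. \<omega> \<in> G n \<sigma> \<and> e \<in> F n \<sigma>)" for \<omega> e
  proof
    assume "(\<omega>, e) \<in> A"
    then obtain \<sigma> where "\<omega> \<in> space M" and \<sigma>: "\<And>n. \<omega> \<in> B n \<sigma> \<and> e \<in> F0 n \<sigma>"
      using A0 by meson
    have "\<forall>n. \<exists>i. dist e (d i) \<le> (1/2) ^ n"
      using d by simp
    then obtain \<rho> where \<rho>: "\<And>n. dist e (d (\<rho> n)) \<le> (1/2) ^ n"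
      by metis
    define \<tau> where "\<tau> j = (if even j then \<sigma> (j div 2) else \<rho> (j div 2))" for j
    have "(\<lambda>j. \<tau> (2 * j)) = \<sigma>" "\<And>n. \<tau> (2 * n + 1) = \<rho> n"
      by (auto simp: \<tau>_def)
    then have "\<forall>n. \<omega> \<in> G n \<tau> \<and> e \<in> F n \<tau>"
      using \<sigma> \<rho> unfolding G_def F_def by (simp add: dist_commute)
    with \<open>\<omega> \<in> space M\<close> show "\<omega> \<in> space M \<and> (\<exists>\<sigma>. \<forall>n. \<omega> \<in> G n \<sigma> \<and> e \<in> F n \<sigma>)"
      by blast
  next
    assume "\<omega> \<in> space M \<and> (\<exists>\<sigma>. \<forall>n. \<omega> \<in> G n \<sigma> \<and> e \<in> F n \<sigma>)"
    then obtain \<sigma> where "\<omega> \<in> space M" "\<And>n. \<omega> \<in> B n (\<lambda>j. \<sigma> (2 * j)) \<and> e \<in> F0 n (\<lambda>j. \<sigma> (2 * j))"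
      unfolding G_def F_def by blast
    then show "(\<omega>, e) \<in> A"
      unfolding A0 by blast
  qed
  have "\<forall>m. \<exists>N. \<forall>\<sigma> \<tau>. (\<forall>i<N. \<sigma> i = \<tau> i) \<longrightarrow> (G m \<sigma>, F m \<sigma>) = (G m \<tau>, F m \<tau>)"
    using finitely_determined_combine[OF dG dF, of Pair] unfolding finitely_determined_def by blast
  then obtain N where N: "\<And>m \<sigma> \<tau>. (\<forall>i<N m. \<sigma> i = \<tau> i) \<Longrightarrow> G m \<sigma> = G m \<tau> \<and> F m \<sigma> = F m \<tau>"
    by (drule_tac choice) auto
  \<comment> \<open>The conditions imposed at depth \<open>n\<close>: those that a sequence of length \<open>n\<close> decides, and only
    finitely many. Every condition is imposed from some depth on.\<close>
  define I where "I n = {m. m \<le> n \<and> N m \<le> n}" for n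
  define ext where "ext s = (\<lambda>i. if i < length s then s ! i else (0::nat))" for s
  define D where "D s = {\<omega> \<in> space M. (\<forall>m\<in>I (length s). \<omega> \<in> G m (ext s)) \<and>
      (\<Inter>m\<in>I (length s). F m (ext s)) \<noteq> {}}" for s
  define c where "c s = (SOME e. e \<in> (\<Inter>m\<in>I (length s). F m (ext s)))" for s
  have c_in: "c s \<in> (\<Inter>m\<in>I (length s). F m (ext s))" if "(\<Inter>m\<in>I (length s). F m (ext s)) \<noteq> {}" for s
    unfolding c_def by (rule someI_ex) (use that in blast)
  have prefix: "G m (ext (map \<sigma> [0..<n])) = G m \<sigma>" "F m (ext (map \<sigma> [0..<n])) = F m \<sigma>"
    if "m \<in> I n" for m n \<sigma>
    using N[of m "ext (map \<sigma> [0..<n])" \<sigma>] that by (auto simp: I_def ext_def)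
  have mD: "D s \<in> sets M" for s
  proof -
    have "countable (I (length s))"
      by (simp add: I_def)
    then have "{\<omega> \<in> space M. \<forall>m\<in>I (length s). \<omega> \<in> G m (ext s)} \<in> sets M"
      using mG by (intro sets.sets_Collect_countable_Ball) auto
    then show ?thesis
      unfolding D_def by (cases "(\<Inter>m\<in>I (length s). F m (ext s)) = {}") simp_all
  qed
  have decD: "D (s @ [j]) \<subseteq> D s" for s j
  proof -
    have "G m (ext (s @ [j])) = G m (ext s)" "F m (ext (s @ [j])) = F m (ext s)" if "m \<in> I (length s)" for m
      using N[of m "ext (s @ [j])" "ext s"] that by (auto simp: I_def ext_def nth_append)
    moreover have "I (length s) \<subseteq> I (length (s @ [j]))"
      by (auto simp: I_def)
    ultimately show ?thesis
      unfolding D_def by fastforce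
  qed
  have into: "\<exists>\<sigma>. \<forall>n. \<omega> \<in> D (map \<sigma> [0..<n])" if wA: "(\<omega>, e) \<in> A" for \<omega> e
  proof -
    obtain \<sigma> where "\<omega> \<in> space M" and \<sigma>: "\<And>n. \<omega> \<in> G n \<sigma> \<and> e \<in> F n \<sigma>"
      using wA A_iff by meson
    have "\<omega> \<in> D (map \<sigma> [0..<n])" for n
    proof -
      have "(\<Inter>m\<in>I n. F m \<sigma>) \<noteq> {}"
        using \<sigma> by blast
      then show ?thesis
        using \<sigma> prefix \<open>\<omega> \<in> space M\<close> by (auto simp: D_def)
    qed
    then show ?thesis
      by blast
  qed
  have onto: "\<exists>e. (\<lambda>n. c (map \<sigma> [0..<n])) \<longlonglongrightarrow> e \<and> (\<omega>, e) \<in> A"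
    if \<sigma>: "\<forall>n. \<omega> \<in> D (map \<sigma> [0..<n])" for \<omega> \<sigma>
  proof -
    let ?p = "\<lambda>n. c (map \<sigma> [0..<n])"
    have evI: "m \<in> I n" if "n \<ge> max m (N m)" for m n
      using that by (auto simp: I_def)
    have p: "?p n \<in> F m \<sigma>" if "n \<ge> max m (N m)" for m n
    proof -
      have "(\<Inter>m\<in>I n. F m (ext (map \<sigma> [0..<n]))) \<noteq> {}"
        using \<sigma>[rule_format, of n] by (simp add: D_def)
      then have "?p n \<in> (\<Inter>m\<in>I n. F m (ext (map \<sigma> [0..<n])))"
        using c_in[of "map \<sigma> [0..<n]"] by simp
      then have "?p n \<in> F m (ext (map \<sigma> [0..<n]))"
        using evI[OF that] by blast
      then show ?thesis
        by (simp only: prefix(2)[OF evI[OF that]])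
    qed
    have "Cauchy ?p"
    proof (rule metric_CauchyI)
      fix r :: real assume "r > 0"
      obtain m where m: "(1/2::real) ^ m < r / 2"
        using real_arch_pow_inv[of "r / 2" "1/2"] \<open>r > 0\<close> by auto
      have "dist (?p i) (?p j) < r" if "i \<ge> max m (N m)" "j \<ge> max m (N m)" for i j
      proof -
        have "dist (d (\<sigma> (2 * m + 1))) (?p i) \<le> (1/2) ^ m" "dist (d (\<sigma> (2 * m + 1))) (?p j) \<le> (1/2) ^ m"
          using p[OF that(1)] p[OF that(2)] by (auto simp: F_def)
        then have "dist (?p i) (?p j) \<le> (1/2) ^ m + (1/2) ^ m"
          by (rule dist_triangle3[THEN order_trans, OF add_mono])
        with m show ?thesis
          by simp
      qed
      then show "\<exists>L. \<forall>i\<ge>L. \<forall>j\<ge>L. dist (?p i) (?p j) < r"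
        by blast
    qed
    then obtain e where e: "?p \<longlonglongrightarrow> e"
      using Cauchy_convergent convergentD by blast
    have "e \<in> F m \<sigma>" for m
      using p by (intro Lim_in_closed_set[OF cF _ _ e] eventually_sequentiallyI[of "max m (N m)"]) auto
    moreover have "\<omega> \<in> G m \<sigma>" for m
    proof -
      have "m \<in> I (max m (N m))"
        by (rule evI) simp
      moreover have "\<omega> \<in> D (map \<sigma> [0..<max m (N m)])"
        using \<sigma> by blast
      ultimately have "\<omega> \<in> G m (ext (map \<sigma> [0..<max m (N m)]))"
        by (simp add: D_def)
      then show ?thesis
        by (simp only: prefix(1)[OF \<open>m \<in> I (max m (N m))\<close>])
    qed
    moreover have "\<omega> \<in> space M"
      using \<sigma> by (auto simp: D_def)
    ultimately show ?thesis
      using e by (auto simp: A_iff)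
  qed
  show thesis
    by (rule that[OF mD decD into onto])
qed

fun branch :: "(nat list \<Rightarrow> nat) \<Rightarrow> nat \<Rightarrow> nat list" where
  "branch J 0 = []"
| "branch J (Suc n) = branch J n @ [J (branch J n)]"

lemma branch_conv_map: "branch J n = map (\<lambda>i. J (branch J i)) [0..<n]"
  by (induction n) auto

lemma branch_induct:
  assumes "P []" "\<And>s. P s \<Longrightarrow> P (s @ [J s])"
  shows "P (branch J n)"
  by (induction n) (auto intro: assms)

lemma tree_prefix_mono:
  assumes "\<And>s j. D (s @ [j]) \<subseteq> D s"
  shows "D (s @ t) \<subseteq> D s"
proof (induction t rule: rev_induct)
  case (snoc j t)
  then show ?case
    using assms[of "s @ t" j] by auto
qed simp

text \<open>
  Outer measure is continuous along increasing sequences of arbitrary sets. So if the terms of the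
  branches are bounded one after the other, each by a sufficiently large number, the outer measure of
  the set of points that lie on a branch stays above \<open>a\<close> all the time. At each depth this leaves
  finitely many nodes, whose measurable union has measure at least \<open>a\<close>.
\<close>

lemma (in finite_measure) tree_bound:
  fixes D :: "nat list \<Rightarrow> 'a set"
  assumes mD: "\<And>s. D s \<in> sets M" and P: "P = {\<omega> \<in> space M. \<exists>\<sigma>. \<forall>n. \<omega> \<in> D (map \<sigma> [0..<n])}"
    and a: "a < outer_measure_of M P"
  obtains k :: "nat \<Rightarrow> nat" where
    "\<And>n. a \<le> emeasure M (\<Union>t\<in>{t. length t = n \<and> (\<forall>i<n. t ! i \<le> k i)}. D t)"
proof -
  define Q where "Q s = {\<omega> \<in> space M. \<exists>\<sigma>. (\<forall>i<length s. \<sigma> i \<le> s ! i) \<and> (\<forall>n. \<omega> \<in> D (map \<sigma> [0..<n]))}"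
    for s :: "nat list"
  have "\<exists>j. a < outer_measure_of M (Q (s @ [j]))" if "a < outer_measure_of M (Q s)" for s
  proof -
    have "Q s = (\<Union>j. Q (s @ [j]))"
    proof (intro equalityI subsetI)
      fix \<omega> assume "\<omega> \<in> Q s"
      then obtain \<sigma> where "\<omega> \<in> space M" "\<forall>i<length s. \<sigma> i \<le> s ! i" "\<forall>n. \<omega> \<in> D (map \<sigma> [0..<n])"
        by (auto simp: Q_def)
      then have "\<omega> \<in> Q (s @ [\<sigma> (length s)])"
        by (auto simp: Q_def nth_append less_Suc_eq intro!: exI[of _ \<sigma>])
      then show "\<omega> \<in> (\<Union>j. Q (s @ [j]))"
        by blast
    next
      fix \<omega> assume "\<omega> \<in> (\<Union>j. Q (s @ [j]))"
      then show "\<omega> \<in> Q s"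
        by (auto simp: Q_def nth_append) (metis less_SucI)
    qed
    moreover have "incseq (\<lambda>j. Q (s @ [j]))"
    proof (intro monoI subsetI)
      fix i j \<omega> assume "i \<le> j" "\<omega> \<in> Q (s @ [i])"
      then obtain \<sigma> where "\<omega> \<in> space M" "\<forall>l<Suc (length s). \<sigma> l \<le> (s @ [i]) ! l" "\<forall>n. \<omega> \<in> D (map \<sigma> [0..<n])"
        by (auto simp: Q_def)
      moreover have "(s @ [i]) ! l \<le> (s @ [j]) ! l" if "l < Suc (length s)" for l
        using \<open>i \<le> j\<close> that by (auto simp: nth_append)
      ultimately show "\<omega> \<in> Q (s @ [j])"
        unfolding Q_def by (auto intro!: exI[of _ \<sigma>]) (metis order_trans)
    qed
    ultimately have "outer_measure_of M (Q s) = (SUP j. outer_measure_of M (Q (s @ [j])))"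
      using SUP_outer_measure_of_incseq[of "\<lambda>j. Q (s @ [j])" M] by (auto simp: Q_def)
    then show ?thesis
      using that by (simp add: less_SUP_iff)
  qed
  then obtain J where J: "\<And>s. a < outer_measure_of M (Q s) \<Longrightarrow> a < outer_measure_of M (Q (s @ [J s]))"
    by metis
  define k where "k i = J (branch J i)" for i
  have "a \<le> emeasure M (\<Union>t\<in>{t. length t = n \<and> (\<forall>i<n. t ! i \<le> k i)}. D t)" (is "_ \<le> emeasure M ?U") for n
  proof -
    have "Q [] = P"
      by (simp add: Q_def P)
    then have "a < outer_measure_of M (Q (branch J n))"
      using branch_induct[of "\<lambda>s. a < outer_measure_of M (Q s)" J n] a J by simp
    also have "\<dots> \<le> outer_measure_of M ?U"
    proof (rule outer_measure_of_mono, rule subsetI)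
      fix \<omega> assume "\<omega> \<in> Q (branch J n)"
      moreover have "length (branch J n) = n" "\<And>i. i < n \<Longrightarrow> branch J n ! i = k i"
        by (subst branch_conv_map, simp add: k_def)+
      ultimately obtain \<sigma> where "\<forall>i<n. \<sigma> i \<le> k i" "\<omega> \<in> D (map \<sigma> [0..<n])"
        by (auto simp: Q_def)
      then show "\<omega> \<in> ?U"
        by (intro UN_I[of "map \<sigma> [0..<n]"]) auto
    qed
    also have "\<dots> = emeasure M ?U"
      using mD by (intro outer_measure_of_eq sets.countable_UN') auto
    finally show ?thesis
      by simp
  qed
  then show thesis
    by (rule that)
qed

text \<open>
  With bounded terms the tree is finitely branching, so by Koenig's lemma a point that meets every
  level lies on an infinite branch; the set of these points is the intersection of a decreasing sequence
  of measurable sets of measure at least \<open>a > 0\<close>. Choosing the least possible child at each node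
  gives a branch that depends measurably on the point.
\<close>

lemma (in finite_measure) measurable_branch_selection:
  fixes D :: "nat list \<Rightarrow> 'a set"
  assumes mD: "\<And>s. D s \<in> sets M" and decD: "\<And>s j. D (s @ [j]) \<subseteq> D s"
    and pos: "outer_measure_of M {\<omega> \<in> space M. \<exists>\<sigma>. \<forall>n. \<omega> \<in> D (map \<sigma> [0..<n])} > 0"
  obtains B S where "B \<in> sets M" "emeasure M B > 0"
    "\<And>n. (\<lambda>\<omega>. branch (S \<omega>) n) \<in> measurable M (count_space UNIV)"
    "\<And>\<omega> n. \<omega> \<in> B \<Longrightarrow> \<omega> \<in> D (branch (S \<omega>) n)"
proof -
  obtain a where a: "0 < a" "a < outer_measure_of M {\<omega> \<in> space M. \<exists>\<sigma>. \<forall>n. \<omega> \<in> D (map \<sigma> [0..<n])}"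
    using dense[OF pos] by blast
  obtain k where k: "\<And>n. a \<le> emeasure M (\<Union>t\<in>{t. length t = n \<and> (\<forall>i<n. t ! i \<le> k i)}. D t)"
    using tree_bound[OF mD refl a(2)] by blast
  define bounded where "bounded s \<longleftrightarrow> (\<forall>i<length s. s ! i \<le> k i)" for s
  \<comment> \<open>The points for which the part of the bounded tree above \<open>s\<close> has nodes of every height.\<close>
  define T where "T s = (\<Inter>n. \<Union>t\<in>{t. length t = n \<and> bounded (s @ t)}. D (s @ t))" for s
  have mT: "T s \<in> sets M" for s
    unfolding T_def using mD by (intro sets.countable_INT sets.countable_UN' image_subsetI) auto
  have T_D: "T s \<subseteq> D s" for s
  proof -
    have "T s \<subseteq> (\<Union>t\<in>{t. length t = 0 \<and> bounded (s @ t)}. D (s @ t))"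
      unfolding T_def by (rule INT_lower) simp
    also have "\<dots> \<subseteq> D s"
      by auto
    finally show ?thesis .
  qed
  have bounded_prefix: "bounded s" if "bounded (s @ t)" for s t
    unfolding bounded_def
  proof (intro allI impI)
    fix i assume "i < length s"
    then show "s ! i \<le> k i"
      using that[unfolded bounded_def, rule_format, of i] by (simp add: nth_append)
  qed
  have step: "\<exists>j. \<omega> \<in> T (s @ [j])" if wT: "\<omega> \<in> T s" for \<omega> s
  proof (rule ccontr)
    assume "\<not> ?thesis"
    then have "\<forall>j. \<exists>n. \<forall>t. length t = n \<and> bounded ((s @ [j]) @ t) \<longrightarrow> \<omega> \<notin> D ((s @ [j]) @ t)"
      unfolding T_def by blast
    then obtain h where h: "\<And>j t. length t = h j \<Longrightarrow> bounded ((s @ [j]) @ t) \<Longrightarrow> \<omega> \<notin> D ((s @ [j]) @ t)"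
      by metis
    \<comment> \<open>If no child of \<open>s\<close> has nodes of every height above it, then their heights have a maximum,
      because there are finitely many children; but there is a node above \<open>s\<close> of greater height.\<close>
    define m where "m = Max (h ` {..k (length s)})"
    obtain t where t: "length t = Suc m" "bounded (s @ t)" "\<omega> \<in> D (s @ t)"
      using wT unfolding T_def by blast
    then obtain j u where ju: "t = j # u"
      by (cases t) auto
    have "j \<le> k (length s)"
      using t(2)[unfolded bounded_def, rule_format, of "length s"] ju by simp
    then have "h j \<le> length u"
      using t(1) ju by (auto simp: m_def)
    then have "length (take (h j) u) = h j"
      by simp
    moreover have eq: "s @ t = ((s @ [j]) @ take (h j) u) @ drop (h j) u"
      by (simp add: ju)
    moreover have "bounded ((s @ [j]) @ take (h j) u)"
      using t(2) bounded_prefix unfolding eq by blast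
    moreover have "\<omega> \<in> D ((s @ [j]) @ take (h j) u)"
      using t(3) tree_prefix_mono[of D, OF decD] unfolding eq by blast
    ultimately show False
      using h by blast
  qed
  define S where "S \<omega> s = (LEAST j. \<omega> \<in> T (s @ [j]))" for \<omega> s
  have S_step: "\<omega> \<in> T (s @ [S \<omega> s])" if "\<omega> \<in> T s" for \<omega> s
    unfolding S_def by (rule LeastI_ex[OF step[OF that]])
  have "branch (S \<omega>) n \<in> {s. \<omega> \<in> T s}" if "\<omega> \<in> T []" for \<omega> n
    using branch_induct[of "\<lambda>s. \<omega> \<in> T s" "S \<omega>" n, OF that S_step] by simp
  then have "\<omega> \<in> D (branch (S \<omega>) n)" if "\<omega> \<in> T []" for \<omega> n
    using that T_D by blast
  moreover have "(\<lambda>\<omega>. branch (S \<omega>) n) \<in> measurable M (count_space UNIV)" for n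
  proof (induction n)
    case (Suc n)
    have S: "(\<lambda>\<omega>. S \<omega> s) \<in> measurable M (count_space UNIV)" for s
      unfolding S_def using mT by measurable
    have "(\<lambda>\<omega>. (\<lambda>s \<omega>. s @ [S \<omega> s]) (branch (S \<omega>) n) \<omega>) \<in> measurable M (count_space UNIV)"
      by (rule measurable_compose_countable[OF _ Suc]) (rule measurable_compose[OF S], simp)
    then show ?case
      by simp
  qed simp
  moreover have "emeasure M (T []) > 0"
  proof -
    let ?Q = "\<lambda>n. \<Union>t\<in>{t. length t = n \<and> (\<forall>i<n. t ! i \<le> k i)}. D t"
    have mQ: "?Q n \<in> sets M" for n
      using mD by (intro sets.countable_UN') auto
    have "decseq ?Q"
    proof (rule decseq_SucI, rule subsetI)
      fix n \<omega> assume "\<omega> \<in> ?Q (Suc n)"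
      then obtain t where t: "length t = Suc n" "\<forall>i<Suc n. t ! i \<le> k i" "\<omega> \<in> D t"
        by blast
      then have eq: "t = take n t @ [t ! n]"
        by (metis lessI take_Suc_conv_app_nth take_all_iff order_refl)
      then have "\<omega> \<in> D (take n t)"
        using t(3) decD[of "take n t" "t ! n"] by auto
      then show "\<omega> \<in> ?Q n"
        using t by (intro UN_I[of "take n t"]) auto
    qed
    then have "(INF n. emeasure M (?Q n)) = emeasure M (\<Inter>n. ?Q n)"
      using mQ by (intro INF_emeasure_decseq') auto
    moreover have "(\<Inter>n. ?Q n) = T []"
      unfolding T_def bounded_def by (intro INF_cong refl SUP_cong) auto
    moreover have "a \<le> (INF n. emeasure M (?Q n))"
      using k by (intro INF_greatest) auto
    ultimately show ?thesis
      using a(1) by simp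
  qed
  ultimately show thesis
    using that[of "T []" S] mT by blast
qed

text \<open>
  The measure-theoretic content of the theorems on measurable projection and measurable selection: if
  the projection of \<open>A\<close> had positive outer measure, a branch selection would yield a measurable
  function whose graph meets \<open>A\<close> over a set of positive measure.
\<close>

lemma (in finite_measure) null_projection_finite:
  fixes A :: "('a \<times> 'e::{complete_space, second_countable_topology}) set"
  assumes A: "A \<in> sets (M \<Otimes>\<^sub>M borel)"
    and null: "\<And>x. x \<in> borel_measurable M \<Longrightarrow> AE \<omega> in M. (\<omega>, x \<omega>) \<notin> A"
  shows "AE \<omega> in M. \<forall>e. (\<omega>, e) \<notin> A"
proof -
  obtain C :: "'e set" where C: "countable C" "\<And>X. open X \<Longrightarrow> X \<noteq> {} \<Longrightarrow> \<exists>d\<in>C. d \<in> X"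
    by (erule countable_dense_setE)
  have "C \<noteq> {}"
    using C(2)[of UNIV] by auto
  have "\<exists>n. dist x (from_nat_into C n) \<le> r" if r: "r > 0" for x r
  proof -
    obtain d where "d \<in> C" "d \<in> ball x r"
      using C(2)[of "ball x r"] r by (metis centre_in_ball empty_iff open_ball)
    then show ?thesis
      using from_nat_into_surj[OF C(1)] by (metis less_imp_le mem_ball)
  qed
  then have small: "\<exists>d :: nat \<Rightarrow> 'e. \<forall>x. \<forall>r>0. \<exists>n. dist x (d n) \<le> r"
    by blast
  obtain D :: "nat list \<Rightarrow> 'a set" and c :: "nat list \<Rightarrow> 'e" where mD: "\<And>s. D s \<in> sets M" and decD: "\<And>s j. D (s @ [j]) \<subseteq> D s" and
    into: "\<And>\<omega> e. (\<omega>, e) \<in> A \<Longrightarrow> \<exists>\<sigma>. \<forall>n. \<omega> \<in> D (map \<sigma> [0..<n])" and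
    onto: "\<And>\<omega> \<sigma>. \<forall>n. \<omega> \<in> D (map \<sigma> [0..<n]) \<Longrightarrow>
      \<exists>e. (\<lambda>n. c (map \<sigma> [0..<n])) \<longlonglongrightarrow> e \<and> (\<omega>, e) \<in> A"
    using souslin_tree[OF souslin_measurable[OF A] small] by blast
  define P where "P = {\<omega> \<in> space M. \<exists>\<sigma>. \<forall>n. \<omega> \<in> D (map \<sigma> [0..<n])}"
  have "outer_measure_of M P = 0"
  proof (rule ccontr)
    assume "outer_measure_of M P \<noteq> 0"
    then have "outer_measure_of M P > 0"
      by (simp add: zero_less_iff_neq_zero)
    then obtain B S where B: "B \<in> sets M" "emeasure M B > 0" and
      mS: "\<And>n. (\<lambda>\<omega>. branch (S \<omega>) n) \<in> measurable M (count_space UNIV)" and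
      S: "\<And>\<omega> n. \<omega> \<in> B \<Longrightarrow> \<omega> \<in> D (branch (S \<omega>) n)"
      using measurable_branch_selection[OF mD decD] unfolding P_def by blast
    define y where "y n \<omega> = (if \<omega> \<in> B then c (branch (S \<omega>) n) else c [])" for n \<omega>
    have lim: "\<exists>e. (\<lambda>n. y n \<omega>) \<longlonglongrightarrow> e \<and> (\<omega> \<in> B \<longrightarrow> (\<omega>, e) \<in> A)" for \<omega>
    proof (cases "\<omega> \<in> B")
      case True
      have "\<forall>n. \<omega> \<in> D (map (\<lambda>i. S \<omega> (branch (S \<omega>) i)) [0..<n])"
        using S[OF True] by (simp flip: branch_conv_map)
      from onto[OF this] show ?thesis
        using True by (simp add: y_def flip: branch_conv_map)
    qed (auto simp: y_def)
    then obtain x where x: "\<And>\<omega>. (\<lambda>n. y n \<omega>) \<longlonglongrightarrow> x \<omega>" and xA: "\<And>\<omega>. \<omega> \<in> B \<Longrightarrow> (\<omega>, x \<omega>) \<in> A"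
      by metis
    have "(\<lambda>\<omega>. c (branch (S \<omega>) n)) \<in> borel_measurable M" for n
      by (rule measurable_compose[OF mS]) simp
    then have "y n \<in> borel_measurable M" for n
      unfolding y_def using B(1) by (intro measurable_If_set) auto
    then have "x \<in> borel_measurable M"
      using x by (intro borel_measurable_LIMSEQ_metric[of y M x])
    from null[OF this] have "AE \<omega> in M. \<omega> \<notin> B"
      by eventually_elim (use xA in blast)
    then have "emeasure M B = 0"
      using B(1) by (simp add: AE_iff_null_sets[OF B(1), symmetric] null_setsD1)
    with B(2) show False
      by simp
  qed
  moreover obtain N where "N \<in> sets M" "P \<subseteq> N" "outer_measure_of M P = emeasure M N"
    using outer_measure_of_attain[of P M] by (auto simp: P_def)
  ultimately have "N \<in> null_sets M" "P \<subseteq> N"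
    by auto
  then show ?thesis
    by (rule AE_I'[OF _ order_trans[rotated]]) (use into in \<open>auto simp: P_def\<close>)
qed

text \<open>
  A \<open>\<sigma>\<close>-finite measure has the same null sets as some finite measure.
\<close>

lemma (in sigma_finite_measure) null_projection:
  fixes A :: "('a \<times> 'e::{complete_space, second_countable_topology}) set"
  assumes A: "A \<in> sets (M \<Otimes>\<^sub>M borel)"
    and null: "\<And>x. x \<in> borel_measurable M \<Longrightarrow> AE \<omega> in M. (\<omega>, x \<omega>) \<notin> A"
  shows "AE \<omega> in M. \<forall>e. (\<omega>, e) \<notin> A"
proof -
  obtain h where h: "h \<in> borel_measurable M" "integral\<^sup>N M h \<noteq> \<infinity>" "\<And>\<omega>. \<omega> \<in> space M \<Longrightarrow> 0 < h \<omega>"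
    using Ex_finite_integrable_function by blast
  have AE: "(AE \<omega> in density M h. Q \<omega>) \<longleftrightarrow> (AE \<omega> in M. Q \<omega>)" for Q
    using h(3) by (auto simp: AE_density[OF h(1)] intro!: AE_cong)
  have "emeasure (density M h) (space M) = integral\<^sup>N M h"
    using h(1) by (auto simp: emeasure_density intro!: nn_integral_cong)
  then interpret h: finite_measure "density M h"
    using h(2) by (intro finite_measureI) simp
  have "sets (density M h \<Otimes>\<^sub>M borel) = sets (M \<Otimes>\<^sub>M (borel :: 'e measure))"
    by (rule sets_pair_measure_cong) auto
  then have "AE \<omega> in density M h. \<forall>e. (\<omega>, e) \<notin> A"
    using A null by (intro h.null_projection_finite) (simp_all add: AE)
  then show ?thesis
    by (simp only: AE)
qed

section \<open>Interchange of integration and supremum\<close>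

text \<open>
  The pointwise supremum of \<open>k \<omega>\<close> over \<open>e\<close> need not be measurable. It is replaced by a countable supremum
  \<open>U\<close> along a maximizing sequence of measurable functions. Since two functions may be combined by
  choosing the larger value at each point, adding one more function to the sequence cannot raise the
  integral of the supremum. So \<open>U\<close> dominates every measurable selection almost everywhere, and the set
  where \<open>k\<close> exceeds \<open>U\<close> has a null projection.
\<close>

lemma (in sigma_finite_measure) nn_integral_sup_selections:
  fixes k :: "'a \<Rightarrow> 'e::{complete_space, second_countable_topology} \<Rightarrow> ennreal"
  assumes k: "(\<lambda>(\<omega>, e). k \<omega> e) \<in> borel_measurable (M \<Otimes>\<^sub>M borel)"
  obtains U where "U \<in> borel_measurable M" "AE \<omega> in M. \<forall>e. k \<omega> e \<le> U \<omega>"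
    "(\<integral>\<^sup>+\<omega>. U \<omega> \<partial>M) = (SUP x\<in>borel_measurable M. \<integral>\<^sup>+\<omega>. k \<omega> (x \<omega>) \<partial>M)"
proof -
  define C where "C = (SUP x\<in>borel_measurable M. \<integral>\<^sup>+\<omega>. k \<omega> (x \<omega>) \<partial>M)"
  have mk[measurable]: "(\<lambda>\<omega>. k \<omega> (x \<omega>)) \<in> borel_measurable M" if "x \<in> borel_measurable M" for x
    using measurable_compose[OF _ k, of "\<lambda>\<omega>. (\<omega>, x \<omega>)" M] that by simp
  have le_C: "(\<integral>\<^sup>+\<omega>. k \<omega> (x \<omega>) \<partial>M) \<le> C" if "x \<in> borel_measurable M" for x
    unfolding C_def using that by (rule SUP_upper)
  have family: "(\<integral>\<^sup>+\<omega>. (SUP n. k \<omega> (X n \<omega>)) \<partial>M) \<le> C"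
    if X: "\<And>n. X n \<in> borel_measurable M" for X :: "nat \<Rightarrow> 'a \<Rightarrow> 'e"
  proof -
    \<comment> \<open>\<open>Y n\<close> takes at each point the best of the values of \<open>X 0, \<dots>, X n\<close>.\<close>
    define Y where "Y = rec_nat (X 0) (\<lambda>n y \<omega>. if k \<omega> (X (Suc n) \<omega>) \<le> k \<omega> (y \<omega>) then y \<omega> else X (Suc n) \<omega>)"
    have Y0: "Y 0 = X 0" and
      YSuc: "\<And>n. Y (Suc n) = (\<lambda>\<omega>. if k \<omega> (X (Suc n) \<omega>) \<le> k \<omega> (Y n \<omega>) then Y n \<omega> else X (Suc n) \<omega>)"
      by (simp_all add: Y_def fun_eq_iff)
    have mY: "Y n \<in> borel_measurable M" for n
    proof (induction n)
      case (Suc n)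
      note [measurable] = Suc X mk[OF Suc] mk[OF X]
      show ?case
        unfolding YSuc by measurable
    qed (simp add: Y0 X)
    have XY: "k \<omega> (X n \<omega>) \<le> k \<omega> (Y n \<omega>)" for n \<omega>
      by (cases n) (auto simp: Y0 YSuc)
    have inc: "incseq (\<lambda>n \<omega>. k \<omega> (Y n \<omega>))"
      by (intro incseq_SucI) (auto simp: YSuc le_fun_def)
    have "(\<integral>\<^sup>+\<omega>. (SUP n. k \<omega> (X n \<omega>)) \<partial>M) \<le> (\<integral>\<^sup>+\<omega>. (SUP n. k \<omega> (Y n \<omega>)) \<partial>M)"
      using XY by (intro nn_integral_mono SUP_mono) blast
    also have "\<dots> = (SUP n. \<integral>\<^sup>+\<omega>. k \<omega> (Y n \<omega>) \<partial>M)"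
      by (rule nn_integral_monotone_convergence_SUP[OF inc mk[OF mY]])
    also have "\<dots> \<le> C"
      using le_C[OF mY] by (rule SUP_least)
    finally show ?thesis .
  qed
  have "\<exists>U\<in>borel_measurable M. (AE \<omega> in M. \<forall>e. k \<omega> e \<le> U \<omega>) \<and> (\<integral>\<^sup>+\<omega>. U \<omega> \<partial>M) \<le> C"
  proof (cases "C = \<infinity>")
    case True
    then show ?thesis
      by (intro bexI[of _ "\<lambda>_. \<infinity>"]) auto
  next
    case False
    have "borel_measurable M \<noteq> ({} :: ('a \<Rightarrow> 'e) set)"
      using borel_measurable_const[of "undefined :: 'e" M] by blast
    from ennreal_SUP_countable_SUP[OF this, of "\<lambda>x. \<integral>\<^sup>+\<omega>. k \<omega> (x \<omega>) \<partial>M"]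
    obtain F :: "nat \<Rightarrow> ennreal" where
      F: "range F \<subseteq> (\<lambda>x. \<integral>\<^sup>+\<omega>. k \<omega> (x \<omega>) \<partial>M) ` borel_measurable M" "C = (SUP n. F n)"
      unfolding C_def by blast
    then have "\<forall>n. \<exists>x\<in>borel_measurable M. F n = (\<integral>\<^sup>+\<omega>. k \<omega> (x \<omega>) \<partial>M)"
      by auto
    then obtain X where X: "\<And>n. X n \<in> borel_measurable M" "\<And>n. F n = (\<integral>\<^sup>+\<omega>. k \<omega> (X n \<omega>) \<partial>M)"
      by metis
    define U where "U \<omega> = (SUP n. k \<omega> (X n \<omega>))" for \<omega>
    have mU[measurable]: "U \<in> borel_measurable M"
      unfolding U_def using mk[OF X(1)] by (intro borel_measurable_SUP) auto
    have "C \<le> (\<integral>\<^sup>+\<omega>. U \<omega> \<partial>M)"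
      unfolding F(2) X(2) by (intro SUP_least nn_integral_mono) (auto simp: U_def intro: SUP_upper)
    moreover have UC: "(\<integral>\<^sup>+\<omega>. U \<omega> \<partial>M) \<le> C"
      unfolding U_def by (rule family[OF X(1)])
    ultimately have U: "(\<integral>\<^sup>+\<omega>. U \<omega> \<partial>M) = C"
      by simp
    have "AE \<omega> in M. k \<omega> (z \<omega>) \<le> U \<omega>" if z: "z \<in> borel_measurable M" for z
    proof -
      define W where "W \<omega> = (SUP n. k \<omega> (case_nat z X n \<omega>))" for \<omega>
      have mzX: "case_nat z X n \<in> borel_measurable M" for n
        using z X(1) by (cases n) auto
      have mW: "W \<in> borel_measurable M"
        unfolding W_def using mk[OF mzX] by (intro borel_measurable_SUP) auto
      have W: "(\<integral>\<^sup>+\<omega>. W \<omega> \<partial>M) \<le> C"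
        unfolding W_def by (rule family[OF mzX])
      have UW: "U \<omega> \<le> W \<omega>" for \<omega>
        unfolding U_def W_def
      proof (rule SUP_mono)
        fix n
        show "\<exists>m\<in>UNIV. k \<omega> (X n \<omega>) \<le> k \<omega> (case_nat z X m \<omega>)"
          by (rule bexI[of _ "Suc n"]) auto
      qed
      have "k \<omega> (z \<omega>) \<le> W \<omega>" for \<omega>
        unfolding W_def by (rule SUP_upper2[of 0]) auto
      moreover have "(\<integral>\<^sup>+\<omega>. W \<omega> - U \<omega> \<partial>M) = 0"
      proof -
        have "(\<integral>\<^sup>+\<omega>. W \<omega> - U \<omega> \<partial>M) = (\<integral>\<^sup>+\<omega>. W \<omega> \<partial>M) - (\<integral>\<^sup>+\<omega>. U \<omega> \<partial>M)"
          using mW mU False U UW by (intro nn_integral_diff) auto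
        also have "\<dots> = 0"
          using U W False by (simp add: diff_eq_0_iff_ennreal less_top)
        finally show ?thesis .
      qed
      then have "AE \<omega> in M. W \<omega> - U \<omega> = 0"
        using mW mU by (simp add: nn_integral_0_iff_AE)
      then have "AE \<omega> in M. W \<omega> \<le> U \<omega>"
        by eventually_elim (auto intro: ennreal_minus_eq_0)
      ultimately show ?thesis
        by (auto elim: eventually_mono intro: order_trans)
    qed
    note sel = this
    define A where "A = {p \<in> space (M \<Otimes>\<^sub>M borel). U (fst p) < (case p of (\<omega>, e) \<Rightarrow> k \<omega> e)}"
    have "A \<in> sets (M \<Otimes>\<^sub>M borel)"
      unfolding A_def using k by measurable
    then have "AE \<omega> in M. \<forall>e. (\<omega>, e) \<notin> A"
    proof (rule null_projection)
      fix x :: "'a \<Rightarrow> 'e" assume "x \<in> borel_measurable M"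
      from sel[OF this] show "AE \<omega> in M. (\<omega>, x \<omega>) \<notin> A"
        by eventually_elim (auto simp: A_def)
    qed
    moreover have "AE \<omega> in M. \<omega> \<in> space M"
      by (rule AE_space)
    ultimately have "AE \<omega> in M. \<forall>e. k \<omega> e \<le> U \<omega>"
      by eventually_elim (auto simp: A_def space_pair_measure not_less)
    with UC mU show ?thesis
      by blast
  qed
  then obtain U where U: "U \<in> borel_measurable M" "AE \<omega> in M. \<forall>e. k \<omega> e \<le> U \<omega>" "(\<integral>\<^sup>+\<omega>. U \<omega> \<partial>M) \<le> C"
    by blast
  have "C \<le> (\<integral>\<^sup>+\<omega>. U \<omega> \<partial>M)"
    unfolding C_def
  proof (rule SUP_least)
    fix x :: "'a \<Rightarrow> 'e"
    show "(\<integral>\<^sup>+\<omega>. k \<omega> (x \<omega>) \<partial>M) \<le> (\<integral>\<^sup>+\<omega>. U \<omega> \<partial>M)"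
      using U(2) by (intro nn_integral_mono_AE) (auto elim: eventually_mono)
  qed
  with U show thesis
    by (intro that[of U]) (auto simp: C_def)
qed

section \<open>Upper integrals\<close>

lemma le_upper_integral:
  assumes "integrable M g" "AE \<omega> in M. ereal (g \<omega>) \<le> v \<omega>"
  shows "ereal (\<integral>\<omega>. g \<omega> \<partial>M) \<le> upper_integral M v"
  unfolding upper_integral_def
proof (rule INF_greatest)
  fix u assume "u \<in> {u. integrable M u \<and> (AE \<omega> in M. v \<omega> \<le> ereal (u \<omega>))}"
  then have u: "integrable M u" "AE \<omega> in M. v \<omega> \<le> ereal (u \<omega>)"
    by auto
  have "AE \<omega> in M. g \<omega> \<le> u \<omega>"
    using assms(2) u(2) by eventually_elim (metis ereal_less_eq(3) order_trans)
  then show "ereal (\<integral>\<omega>. g \<omega> \<partial>M) \<le> ereal (\<integral>\<omega>. u \<omega> \<partial>M)"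
    using assms(1) u(1) by (simp add: integral_mono_AE)
qed

lemma upper_integral_le:
  assumes "integrable M g" "AE \<omega> in M. v \<omega> \<le> ereal (g \<omega>)"
  shows "upper_integral M v \<le> ereal (\<integral>\<omega>. g \<omega> \<partial>M)"
  unfolding upper_integral_def using assms by (intro INF_lower) simp

lemma upper_integral_eq_integral:
  assumes g: "integrable M g" and eq: "AE \<omega> in M. v \<omega> = ereal (g \<omega>)"
  shows "upper_integral M v = ereal (\<integral>\<omega>. g \<omega> \<partial>M)"
proof (rule antisym)
  show "upper_integral M v \<le> ereal (\<integral>\<omega>. g \<omega> \<partial>M)"
    using eq by (intro upper_integral_le[OF g]) (auto elim: eventually_mono)
  show "ereal (\<integral>\<omega>. g \<omega> \<partial>M) \<le> upper_integral M v"
    using eq by (intro le_upper_integral[OF g]) (auto elim: eventually_mono)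
qed

text \<open>
  If \<open>k\<close> were integrable, this would be additivity of the integral. In general \<open>k\<close> may be infinite,
  and \<open>\<sigma>\<close>-finiteness provides an increasing sequence of integrable functions with limit \<open>k\<close>, each of
  which gives an integrable upper bound of \<open>v\<close>.
\<close>

lemma (in sigma_finite_measure) nn_integral_le_of_upper_integral_ge:
  assumes a: "integrable M a" and k: "k \<in> borel_measurable M"
    and v: "AE \<omega> in M. v \<omega> \<le> ereal (a \<omega>) - enn2ereal (k \<omega>)"
    and c: "ereal c \<le> upper_integral M v"
  shows "(\<integral>\<^sup>+\<omega>. k \<omega> \<partial>M) \<le> ennreal ((\<integral>\<omega>. a \<omega> \<partial>M) - c)"
proof -
  obtain h where h: "h \<in> borel_measurable M" "integral\<^sup>N M h \<noteq> \<infinity>"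
    "\<And>\<omega>. \<omega> \<in> space M \<Longrightarrow> 0 < h \<omega>" "\<And>\<omega>. \<omega> \<in> space M \<Longrightarrow> h \<omega> < \<infinity>"
    using Ex_finite_integrable_function by blast
  define \<kappa> where "\<kappa> n \<omega> = min (k \<omega>) (of_nat n * h \<omega>)" for n :: nat and \<omega>
  have m\<kappa>[measurable]: "\<kappa> n \<in> borel_measurable M" for n
    unfolding \<kappa>_def using k h(1) by measurable
  have fin: "\<kappa> n \<omega> < \<infinity>" if "\<omega> \<in> space M" for n \<omega>
    using h(4)[OF that] of_nat_less_top[of n]
    by (simp add: \<kappa>_def min_less_iff_disj ennreal_mult_less_top)
  have inc: "incseq \<kappa>"
    unfolding incseq_def le_fun_def \<kappa>_def
    by (intro allI impI min.mono order_refl mult_right_mono of_nat_mono) simp_all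
  have sup: "(SUP n. \<kappa> n \<omega>) = k \<omega>" if "\<omega> \<in> space M" for \<omega>
  proof -
    have "(\<lambda>n. of_nat n * h \<omega>) \<longlonglongrightarrow> top * h \<omega>"
      using h(3,4)[OF that]
      by (intro tendsto_mult_ennreal of_nat_tendsto_top_ennreal tendsto_const) auto
    then have "(\<lambda>n. of_nat n * h \<omega>) \<longlonglongrightarrow> top"
      using h(3)[OF that] by (simp add: ennreal_top_mult split: if_splits)
    then have "(\<lambda>n. \<kappa> n \<omega>) \<longlonglongrightarrow> min (k \<omega>) top"
      unfolding \<kappa>_def by (intro tendsto_min tendsto_const)
    moreover have "incseq (\<lambda>n. \<kappa> n \<omega>)"
      using inc by (simp add: incseq_def le_fun_def)
    then have "(\<lambda>n. \<kappa> n \<omega>) \<longlonglongrightarrow> (SUP n. \<kappa> n \<omega>)"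
      by (rule LIMSEQ_SUP)
    ultimately show ?thesis
      using LIMSEQ_unique by (metis min_top2)
  qed
  have bound: "(\<integral>\<^sup>+\<omega>. \<kappa> n \<omega> \<partial>M) \<le> ennreal ((\<integral>\<omega>. a \<omega> \<partial>M) - c)" for n
  proof -
    define q where "q \<omega> = enn2real (\<kappa> n \<omega>)" for \<omega>
    have q: "ennreal (q \<omega>) = \<kappa> n \<omega>" if "\<omega> \<in> space M" for \<omega>
      using fin[OF that] by (simp add: q_def)
    have "(\<integral>\<^sup>+\<omega>. \<kappa> n \<omega> \<partial>M) \<le> (\<integral>\<^sup>+\<omega>. of_nat n * h \<omega> \<partial>M)"
      by (intro nn_integral_mono) (simp add: \<kappa>_def)
    also have "\<dots> < \<infinity>"
      using h(1,2) of_nat_less_top[of n] by (simp add: nn_integral_cmult ennreal_mult_less_top less_top)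
    finally have *: "(\<integral>\<^sup>+\<omega>. ennreal (q \<omega>) \<partial>M) < \<infinity>"
      using q by (simp cong: nn_integral_cong)
    have q_nonneg: "0 \<le> q \<omega>" for \<omega>
      by (simp add: q_def)
    have iq: "integrable M q"
    proof (rule integrableI_nonneg)
      show "q \<in> borel_measurable M"
        unfolding q_def by measurable
    qed (use * in \<open>simp_all add: q_def\<close>)
    have "AE \<omega> in M. v \<omega> \<le> ereal (a \<omega> - q \<omega>)"
      using v AE_space
    proof eventually_elim
      case (elim \<omega>)
      have "ereal (q \<omega>) = enn2ereal (\<kappa> n \<omega>)"
        using q[OF elim(2)] by (metis enn2ereal_ennreal enn2real_nonneg q_def)
      also have "\<dots> \<le> enn2ereal (k \<omega>)"
        by (simp add: \<kappa>_def less_eq_ennreal.rep_eq[symmetric])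
      finally have "ereal (a \<omega>) - enn2ereal (k \<omega>) \<le> ereal (a \<omega>) - ereal (q \<omega>)"
        by (intro ereal_minus_mono) auto
      with elim(1) show ?case
        by simp
    qed
    from upper_integral_le[OF Bochner_Integration.integrable_diff[OF a iq] this]
    have "ereal c \<le> ereal (\<integral>\<omega>. a \<omega> - q \<omega> \<partial>M)"
      using c by (rule order_trans[rotated])
    then have "(\<integral>\<omega>. q \<omega> \<partial>M) \<le> (\<integral>\<omega>. a \<omega> \<partial>M) - c"
      using a iq by simp
    moreover have "(\<integral>\<^sup>+\<omega>. \<kappa> n \<omega> \<partial>M) = ennreal (\<integral>\<omega>. q \<omega> \<partial>M)"
      using nn_integral_eq_integral[OF iq] nn_integral_cong[of M "\<lambda>\<omega>. ennreal (q \<omega>)" "\<kappa> n", OF q]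
      q_nonneg by simp
    ultimately show ?thesis
      by (simp add: ennreal_leI)
  qed
  have "(\<integral>\<^sup>+\<omega>. k \<omega> \<partial>M) = (\<integral>\<^sup>+\<omega>. (SUP n. \<kappa> n \<omega>) \<partial>M)"
    using sup by (intro nn_integral_cong) simp
  also have "\<dots> = (SUP n. \<integral>\<^sup>+\<omega>. \<kappa> n \<omega> \<partial>M)"
    by (rule nn_integral_monotone_convergence_SUP[OF inc m\<kappa>])
  also have "\<dots> \<le> ennreal ((\<integral>\<omega>. a \<omega> \<partial>M) - c)"
    using bound by (rule SUP_least)
  finally show ?thesis .
qed

text \<open>
  Finiteness from above provides an integrable majorant \<open>a\<close>; finiteness from below makes \<open>a - v\<close>
  integrable.
\<close>

lemma (in sigma_finite_measure) finite_upper_integral_imp_integrable: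
  assumes v: "v \<in> borel_measurable M" and fin: "\<bar>upper_integral M v\<bar> \<noteq> \<infinity>"
  obtains g where "integrable M g" "AE \<omega> in M. v \<omega> = ereal (g \<omega>)"
proof -
  obtain c where c: "upper_integral M v = ereal c"
    using fin by (cases "upper_integral M v") auto
  then have "upper_integral M v < \<infinity>"
    by simp
  then obtain a where a: "integrable M a" "AE \<omega> in M. v \<omega> \<le> ereal (a \<omega>)"
    unfolding upper_integral_def INF_less_iff by blast
  define k where "k \<omega> = e2ennreal (ereal (a \<omega>) - v \<omega>)" for \<omega>
  have mk[measurable]: "k \<in> borel_measurable M"
    unfolding k_def using v borel_measurable_integrable[OF a(1)] by measurable
  have eq: "AE \<omega> in M. v \<omega> = ereal (a \<omega>) - enn2ereal (k \<omega>)"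
    using a(2)
  proof eventually_elim
    case (elim \<omega>)
    then have "0 \<le> ereal (a \<omega>) - v \<omega>"
      by (cases "v \<omega>") auto
    then have "enn2ereal (k \<omega>) = ereal (a \<omega>) - v \<omega>"
      by (simp add: k_def enn2ereal_e2ennreal)
    then show ?case
      using elim by (cases "v \<omega>") auto
  qed
  have "(\<integral>\<^sup>+\<omega>. k \<omega> \<partial>M) \<le> ennreal ((\<integral>\<omega>. a \<omega> \<partial>M) - c)"
    using eq c by (intro nn_integral_le_of_upper_integral_ge[OF a(1) mk, of v]) (auto elim: eventually_mono)
  then have k_fin: "(\<integral>\<^sup>+\<omega>. k \<omega> \<partial>M) < \<infinity>"
    using order_le_less_trans by fastforce
  then have AE_fin: "AE \<omega> in M. k \<omega> \<noteq> \<infinity>"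
    by (intro nn_integral_PInf_AE) auto
  then have "(\<integral>\<^sup>+\<omega>. ennreal (enn2real (k \<omega>)) \<partial>M) = (\<integral>\<^sup>+\<omega>. k \<omega> \<partial>M)"
    by (intro nn_integral_cong_AE) (auto elim!: eventually_mono simp: less_top)
  then have "integrable M (\<lambda>\<omega>. enn2real (k \<omega>))"
    using k_fin by (intro integrableI_nonneg) auto
  moreover have "AE \<omega> in M. v \<omega> = ereal (a \<omega> - enn2real (k \<omega>))"
    using eq AE_fin
  proof eventually_elim
    case (elim \<omega>)
    then have "enn2ereal (k \<omega>) = ereal (enn2real (k \<omega>))"
      by (cases "k \<omega>") (auto simp: enn2ereal_ennreal)
    with elim(1) show ?case
      by simp
  qed
  ultimately show thesis
    using a(1) by (intro that[of "\<lambda>\<omega>. a \<omega> - enn2real (k \<omega>)"]) auto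
qed

section \<open>Subderivatives and bounded functions\<close>

lemma frechet_subderivative_iff:
  assumes J: "J x0 = ereal j"
  shows "frechet_subderivative X N J L x0 \<longleftrightarrow>
    (\<forall>\<epsilon>>0. \<exists>\<delta>>0. \<forall>x\<in>X. 0 < N (x - x0) \<and> N (x - x0) < \<delta> \<longrightarrow>
       ereal (j + L (x - x0) - \<epsilon> * N (x - x0)) \<le> J x)"
proof -
  define q where "q x = (J x - J x0 - ereal (L (x - x0))) / ereal (N (x - x0))" for x
  have less: "ereal (- \<epsilon>) < q x \<longleftrightarrow> ereal (j + L (x - x0) - \<epsilon> * N (x - x0)) < J x"
    if "0 < N (x - x0)" for x \<epsilon>
    using that by (cases "J x") (auto simp: q_def J field_simps)
  have ev: "eventually P (punctured_at X N x0) \<longleftrightarrow>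
      (\<exists>\<delta>>0. \<forall>x\<in>X. 0 < N (x - x0) \<and> N (x - x0) < \<delta> \<longrightarrow> P x)" for P
  proof
    assume "eventually P (punctured_at X N x0)"
    then obtain Q where Q: "eventually Q (at_right 0)" "\<And>x. x \<in> X \<Longrightarrow> Q (N (x - x0)) \<Longrightarrow> P x"
      unfolding punctured_at_def eventually_inf_principal eventually_filtercomap by blast
    then show "\<exists>\<delta>>0. \<forall>x\<in>X. 0 < N (x - x0) \<and> N (x - x0) < \<delta> \<longrightarrow> P x"
      unfolding eventually_at_right_field by metis
  next
    assume "\<exists>\<delta>>0. \<forall>x\<in>X. 0 < N (x - x0) \<and> N (x - x0) < \<delta> \<longrightarrow> P x"
    then obtain \<delta> where "\<delta> > 0" "\<And>x. x \<in> X \<Longrightarrow> 0 < N (x - x0) \<Longrightarrow> N (x - x0) < \<delta> \<Longrightarrow> P x"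
      by blast
    moreover from this(1) have "eventually (\<lambda>r. 0 < r \<and> r < \<delta>) (at_right 0)"
      unfolding eventually_at_right_field by blast
    ultimately show "eventually P (punctured_at X N x0)"
      unfolding punctured_at_def eventually_inf_principal eventually_filtercomap by blast
  qed
  have "frechet_subderivative X N J L x0 \<longleftrightarrow> (\<forall>y<0. eventually (\<lambda>x. y < q x) (punctured_at X N x0))"
    unfolding frechet_subderivative_def le_Liminf_iff q_def by (simp add: J)
  also have "\<dots> \<longleftrightarrow> (\<forall>\<epsilon>>0. eventually (\<lambda>x. ereal (- \<epsilon>) < q x) (punctured_at X N x0))"
  proof (intro iffI allI impI)
    fix \<epsilon> :: real assume "\<forall>y<0. eventually (\<lambda>x. y < q x) (punctured_at X N x0)" "\<epsilon> > 0"
    then show "eventually (\<lambda>x. ereal (- \<epsilon>) < q x) (punctured_at X N x0)"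
      by (simp add: zero_ereal_def)
  next
    fix y :: ereal assume *: "\<forall>\<epsilon>>0. eventually (\<lambda>x. ereal (- \<epsilon>) < q x) (punctured_at X N x0)" and "y < 0"
    then obtain \<epsilon> where "y < ereal (- \<epsilon>)" "\<epsilon> > 0"
      by (metis ereal_dense2 ereal_less(1) less_ereal.simps(1) minus_minus neg_less_0_iff_less zero_ereal_def)
    with *[rule_format, OF \<open>\<epsilon> > 0\<close>] show "eventually (\<lambda>x. y < q x) (punctured_at X N x0)"
      by (auto elim: eventually_mono)
  qed
  also have "\<dots> \<longleftrightarrow> (\<forall>\<epsilon>>0. \<exists>\<delta>>0. \<forall>x\<in>X. 0 < N (x - x0) \<and> N (x - x0) < \<delta> \<longrightarrow>
       ereal (j + L (x - x0) - \<epsilon> * N (x - x0)) \<le> J x)"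
    (is "?A \<longleftrightarrow> ?B")
  proof
    assume ?A
    then show ?B
      unfolding ev by (metis less less_imp_le)
  next
    assume B: ?B
    show ?A
    proof (intro allI impI)
      fix \<epsilon> :: real assume "\<epsilon> > 0"
      then have "\<epsilon> / 2 > 0"
        by simp
      then obtain \<delta> where \<delta>: "\<delta> > 0" "\<And>x. x \<in> X \<Longrightarrow> 0 < N (x - x0) \<Longrightarrow> N (x - x0) < \<delta> \<Longrightarrow>
         ereal (j + L (x - x0) - \<epsilon> / 2 * N (x - x0)) \<le> J x"
        using B by blast
      have "ereal (- \<epsilon>) < q x" if "x \<in> X" "0 < N (x - x0)" "N (x - x0) < \<delta>" for x
      proof -
        have "j + L (x - x0) - \<epsilon> * N (x - x0) < j + L (x - x0) - \<epsilon> / 2 * N (x - x0)"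
          using \<open>\<epsilon> > 0\<close> that(2) by simp
        then show ?thesis
          using \<delta>(2)[OF that] unfolding less[OF that(2)] by (meson ereal_less_eq(3) less_ereal.simps(1) order_less_le_trans)
      qed
      then show "eventually (\<lambda>x. ereal (- \<epsilon>) < q x) (punctured_at X N x0)"
        unfolding ev using \<delta>(1) by blast
    qed
  qed
  finally show ?thesis .
qed

lemma AE_norm_le_Linf_norm:
  assumes "x \<in> Linf M"
  shows "AE \<omega> in M. norm (x \<omega>) \<le> Linf_norm M x"
proof -
  have "esssup M (\<lambda>\<omega>. ereal (norm (x \<omega>))) < \<infinity>"
    using assms by (simp add: Linf_def)
  then have le: "esssup M (\<lambda>\<omega>. ereal (norm (x \<omega>))) \<le> ereal (Linf_norm M x)"
    unfolding Linf_norm_def by (cases "esssup M (\<lambda>\<omega>. ereal (norm (x \<omega>)))") auto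
  have "AE \<omega> in M. ereal (norm (x \<omega>)) \<le> esssup M (\<lambda>\<omega>. ereal (norm (x \<omega>)))"
    by (rule esssup_AE)
  then show ?thesis
    by eventually_elim (use le in \<open>metis ereal_less_eq(3) order_trans\<close>)
qed

lemma Linf_AE_boundedI:
  assumes x: "x \<in> borel_measurable M" and r: "AE \<omega> in M. norm (x \<omega>) \<le> r" "0 \<le> r"
  shows "x \<in> Linf M" "Linf_norm M x \<le> r"
proof -
  have "esssup M (\<lambda>\<omega>. ereal (norm (x \<omega>))) \<le> ereal r"
  proof (rule esssup_I)
    show "(\<lambda>\<omega>. ereal (norm (x \<omega>))) \<in> borel_measurable M"
      using x by measurable
    show "AE \<omega> in M. ereal (norm (x \<omega>)) \<le> ereal r"
      using r(1) by simp
  qed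
  then show "x \<in> Linf M" "Linf_norm M x \<le> r"
    using x r(2) unfolding Linf_def Linf_norm_def
    by (cases "esssup M (\<lambda>\<omega>. ereal (norm (x \<omega>)))"; auto)+
qed

lemma Linf_diff:
  assumes "x \<in> Linf M" "y \<in> Linf M"
  shows "x - y \<in> Linf M"
proof -
  have [measurable]: "x \<in> borel_measurable M" "y \<in> borel_measurable M"
    using assms by (auto simp: Linf_def)
  have "AE \<omega> in M. norm ((x - y) \<omega>) \<le> max 0 (Linf_norm M x + Linf_norm M y)"
    using AE_norm_le_Linf_norm[OF assms(1)] AE_norm_le_Linf_norm[OF assms(2)]
  proof eventually_elim
    case (elim \<omega>)
    then show ?case
      using norm_triangle_ineq4[of "x \<omega>" "y \<omega>"] by simp
  qed
  then show ?thesis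
    by (intro Linf_AE_boundedI(1)[of "x - y"]) (auto simp: fun_diff_def)
qed

text \<open>
  For a simple function \<open>y\<close> the claim is scalar measurability on each piece; by separability \<open>y\<close> is a
  pointwise limit of simple functions. Reparametrization by \<open>t\<close> covers both \<open>\<omega> \<mapsto> \<langle>xs \<omega>, y \<omega>\<rangle>\<close> and the
  joint measurability of \<open>(\<omega>, e) \<mapsto> \<langle>xs \<omega>, e\<rangle>\<close>.
\<close>

lemma borel_measurable_scalarly_apply:
  fixes xs :: "'w \<Rightarrow> ('e::{real_normed_vector, second_countable_topology} \<Rightarrow>\<^sub>L real)"
  assumes xs: "\<And>e. (\<lambda>\<omega>. blinfun_apply (xs \<omega>) e) \<in> borel_measurable M"
    and t: "t \<in> measurable N M" and y: "y \<in> borel_measurable N"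
  shows "(\<lambda>p. blinfun_apply (xs (t p)) (y p)) \<in> borel_measurable N"
proof -
  obtain F where F: "\<And>i. simple_function N (F i)" "\<And>p. p \<in> space N \<Longrightarrow> (\<lambda>i. F i p) \<longlonglongrightarrow> y p"
    using borel_measurable_implies_sequence_metric[OF y] by blast
  show ?thesis
  proof (rule borel_measurable_LIMSEQ_metric)
    fix i
    have fin: "finite (F i ` space N)"
      using F(1) by (simp add: simple_function_def)
    then have "F i \<in> measurable N (count_space (F i ` space N))"
      using F(1)[of i] by (auto simp: measurable_count_space_eq2 simple_function_def)
    then show "(\<lambda>p. blinfun_apply (xs (t p)) (F i p)) \<in> borel_measurable N"
      by (rule measurable_compose_countable'[OF measurable_compose[OF t xs] _ countable_finite[OF fin]])
  next
    fix p assume "p \<in> space N"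
    then show "(\<lambda>i. blinfun_apply (xs (t p)) (F i p)) \<longlonglongrightarrow> blinfun_apply (xs (t p)) (y p)"
      by (rule blinfun.tendsto[OF tendsto_const F(2)])
  qed
qed

lemma integrable_L1_dual_apply:
  fixes xs :: "'w \<Rightarrow> ('e::{real_normed_vector, second_countable_topology} \<Rightarrow>\<^sub>L real)"
  assumes xs: "xs \<in> L1_dual M" and y: "y \<in> borel_measurable M" and r: "AE \<omega> in M. norm (y \<omega>) \<le> r"
  shows "integrable M (\<lambda>\<omega>. blinfun_apply (xs \<omega>) (y \<omega>))"
proof (rule Bochner_Integration.integrable_bound)
  show "integrable M (\<lambda>\<omega>. r * norm (xs \<omega>))"
    using xs by (simp add: L1_dual_def)
  show "(\<lambda>\<omega>. blinfun_apply (xs \<omega>) (y \<omega>)) \<in> borel_measurable M"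
    by (rule borel_measurable_scalarly_apply[OF _ measurable_ident_sets[OF refl] y]) (use xs in \<open>simp add: L1_dual_def\<close>)
  show "AE \<omega> in M. norm (blinfun_apply (xs \<omega>) (y \<omega>)) \<le> norm (r * norm (xs \<omega>))"
    using r
  proof eventually_elim
    case (elim \<omega>)
    have "norm (blinfun_apply (xs \<omega>) (y \<omega>)) \<le> norm (xs \<omega>) * norm (y \<omega>)"
      by (rule norm_blinfun)
    also have "\<dots> \<le> norm (xs \<omega>) * r"
      using elim by (intro mult_left_mono) auto
    also have "\<dots> \<le> norm (r * norm (xs \<omega>))"
      by (simp add: mult.commute)
    finally show ?case .
  qed
qed

section \<open>Difference quotients\<close>

lemma reduced_quotient_ge_iff:
  assumes "f \<omega> (x0 \<omega>) = ereal g" "r > 0"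
  shows "- ereal u \<le> reduced_quotient f xs x0 e r \<omega> \<longleftrightarrow>
    ereal (g + r * blinfun_apply (xs \<omega>) e - r * u) \<le> f \<omega> (x0 \<omega> + r *\<^sub>R e)"
  using assms by (cases "f \<omega> (x0 \<omega> + r *\<^sub>R e)") (auto simp: reduced_quotient_def field_simps)

lemma measurable_reduced_quotient:
  fixes f :: "'w \<Rightarrow> 'e::{banach, second_countable_topology} \<Rightarrow> ereal"
  assumes f: "(\<lambda>(\<omega>, x). f \<omega> x) \<in> borel_measurable (M \<Otimes>\<^sub>M borel)"
    and x0: "x0 \<in> borel_measurable M"
    and xs: "\<And>e. (\<lambda>\<omega>. blinfun_apply (xs \<omega>) e) \<in> borel_measurable M"
  shows "(\<lambda>(\<omega>, e). reduced_quotient f xs x0 e r \<omega>) \<in> borel_measurable (M \<Otimes>\<^sub>M borel)"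
proof -
  note [measurable] = x0
  have [measurable]: "(\<lambda>p. f (fst p) (x0 (fst p) + r *\<^sub>R snd p)) \<in> borel_measurable (M \<Otimes>\<^sub>M borel)"
    using measurable_compose[OF _ f, of "\<lambda>p. (fst p, x0 (fst p) + r *\<^sub>R snd p)" "M \<Otimes>\<^sub>M borel"] by simp
  have [measurable]: "(\<lambda>p. f (fst p) (x0 (fst p))) \<in> borel_measurable (M \<Otimes>\<^sub>M (borel :: 'e measure))"
    using measurable_compose[OF _ f, of "\<lambda>p. (fst p, x0 (fst p))" "M \<Otimes>\<^sub>M borel"] by simp
  have [measurable]: "(\<lambda>p. blinfun_apply (xs (fst p)) (snd p)) \<in> borel_measurable (M \<Otimes>\<^sub>M borel)"
    using xs by (rule borel_measurable_scalarly_apply) measurable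
  show ?thesis
    unfolding reduced_quotient_def case_prod_beta by measurable
qed

text \<open>
  At distance \<open>r\<close> from \<open>x0\<close>, the quotient bound at \<open>e = (x - x0) / r\<close> reads
  \<open>f(x) \<ge> f(x0) + \<langle>xs, x - x0\<rangle> - r * u r\<close>. After integration, the error is \<open>r\<close> times the norm of \<open>u r\<close>,
  which is small compared with \<open>r\<close>.
\<close>

lemma frechet_subderivative_if_quotient_bound:
  fixes f :: "'w \<Rightarrow> 'e::{banach, second_countable_topology} \<Rightarrow> ereal"
  assumes x0: "x0 \<in> Linf M" and xs: "xs \<in> L1_dual M"
    and g: "integrable M g" "AE \<omega> in M. f \<omega> (x0 \<omega>) = ereal (g \<omega>)"
    and u: "\<forall>\<^sub>F r in at_right 0. integrable M (u r) \<and> (\<forall>\<omega>\<in>space M. 0 \<le> u r \<omega>)"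
      "((\<lambda>r. \<integral>\<omega>. \<bar>u r \<omega>\<bar> \<partial>M) \<longlongrightarrow> 0) (at_right 0)"
      "\<forall>\<^sub>F r in at_right 0. AE \<omega> in M.
          (INF e\<in>cball 0 1. reduced_quotient f xs x0 e r \<omega>) \<ge> - ereal (u r \<omega>)"
  shows "frechet_subderivative (Linf M) (Linf_norm M) (integral_functional M f) (pairing M xs) x0"
proof -
  define j where "j = (\<integral>\<omega>. g \<omega> \<partial>M)"
  have J: "integral_functional M f x0 = ereal j"
    unfolding integral_functional_def j_def by (rule upper_integral_eq_integral[OF g])
  show ?thesis
    unfolding frechet_subderivative_iff[of "integral_functional M f", OF J]
  proof (intro allI impI)
    fix \<epsilon> :: real assume "\<epsilon> > 0"
    then have "\<forall>\<^sub>F r in at_right 0. (\<integral>\<omega>. \<bar>u r \<omega>\<bar> \<partial>M) < \<epsilon>"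
      using order_tendstoD(2)[OF u(2)] by blast
    with u(1,3) have "\<forall>\<^sub>F r in at_right 0. integrable M (u r) \<and> (\<integral>\<omega>. \<bar>u r \<omega>\<bar> \<partial>M) < \<epsilon> \<and>
       (AE \<omega> in M. (INF e\<in>cball 0 1. reduced_quotient f xs x0 e r \<omega>) \<ge> - ereal (u r \<omega>))"
      by eventually_elim auto
    then obtain \<delta> where \<delta>: "\<delta> > 0" and iu: "\<And>r. 0 < r \<Longrightarrow> r < \<delta> \<Longrightarrow> integrable M (u r)"
      and u\<epsilon>: "\<And>r. 0 < r \<Longrightarrow> r < \<delta> \<Longrightarrow> (\<integral>\<omega>. \<bar>u r \<omega>\<bar> \<partial>M) < \<epsilon>"
      and quot: "\<And>r. 0 < r \<Longrightarrow> r < \<delta> \<Longrightarrow>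
        AE \<omega> in M. (INF e\<in>cball 0 1. reduced_quotient f xs x0 e r \<omega>) \<ge> - ereal (u r \<omega>)"
      unfolding eventually_at_right_field by blast
    have "ereal (j + pairing M xs (x - x0) - \<epsilon> * Linf_norm M (x - x0)) \<le> integral_functional M f x"
      if x: "x \<in> Linf M" and r: "0 < Linf_norm M (x - x0)" "Linf_norm M (x - x0) < \<delta>" for x
    proof -
      define r where "r = Linf_norm M (x - x0)"
      have r_pos: "r > 0" and "r < \<delta>"
        using r by (auto simp: r_def)
      have y: "x - x0 \<in> Linf M"
        by (rule Linf_diff[OF x x0])
      then have my: "(\<lambda>\<omega>. x \<omega> - x0 \<omega>) \<in> borel_measurable M"
        by (simp add: Linf_def fun_diff_def)
      have AEr: "AE \<omega> in M. norm (x \<omega> - x0 \<omega>) \<le> r"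
        using AE_norm_le_Linf_norm[OF y] by (simp add: r_def)
      have iy: "integrable M (\<lambda>\<omega>. blinfun_apply (xs \<omega>) (x \<omega> - x0 \<omega>))"
        by (rule integrable_L1_dual_apply[OF xs my AEr])
      note iu = iu[OF r_pos \<open>r < \<delta>\<close>] and u\<epsilon> = u\<epsilon>[OF r_pos \<open>r < \<delta>\<close>]
      define G where "G \<omega> = g \<omega> + blinfun_apply (xs \<omega>) (x \<omega> - x0 \<omega>) - r * u r \<omega>" for \<omega>
      have iG: "integrable M G"
        unfolding G_def using g(1) iy iu by auto
      have "(\<integral>\<omega>. u r \<omega> \<partial>M) \<le> (\<integral>\<omega>. \<bar>u r \<omega>\<bar> \<partial>M)"
        using iu by (intro integral_mono) auto
      then have "r * (\<integral>\<omega>. u r \<omega> \<partial>M) \<le> r * \<epsilon>"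
        using u\<epsilon> r_pos by (intro mult_left_mono) auto
      then have "j + pairing M xs (x - x0) - \<epsilon> * r \<le> (\<integral>\<omega>. G \<omega> \<partial>M)"
        unfolding G_def using g(1) iy iu by (simp add: j_def pairing_def mult.commute)
      moreover have "ereal (\<integral>\<omega>. G \<omega> \<partial>M) \<le> integral_functional M f x"
        unfolding integral_functional_def
      proof (rule le_upper_integral[OF iG])
        show "AE \<omega> in M. ereal (G \<omega>) \<le> f \<omega> (x \<omega>)"
          using quot[OF r_pos \<open>r < \<delta>\<close>] AEr g(2)
        proof eventually_elim
          case (elim \<omega>)
          let ?e = "(x \<omega> - x0 \<omega>) /\<^sub>R r"
          have "norm ?e = norm (x \<omega> - x0 \<omega>) / r"
            using r_pos by (simp add: divide_inverse mult.commute)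
          then have "?e \<in> cball 0 1"
            using elim(2) r_pos by (simp add: mem_cball dist_norm divide_le_eq_1)
          then have "- ereal (u r \<omega>) \<le> reduced_quotient f xs x0 ?e r \<omega>"
            using elim(1) by (meson INF_lower order_trans)
          then show ?case
            using r_pos unfolding reduced_quotient_ge_iff[where f = f and \<omega> = \<omega> and ?x0.0 = x0, OF elim(3) r_pos]
            by (simp add: G_def blinfun.scaleR_right flip: mult.assoc)
        qed
      qed
      ultimately show ?thesis
        by (metis ereal_less_eq(3) order_trans r_def)
    qed
    with \<delta> show "\<exists>\<delta>>0. \<forall>x\<in>Linf M. 0 < Linf_norm M (x - x0) \<and> Linf_norm M (x - x0) < \<delta> \<longrightarrow>
        ereal (j + pairing M xs (x - x0) - \<epsilon> * Linf_norm M (x - x0)) \<le> integral_functional M f x"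
      by blast
  qed
qed

text \<open>
  The negative part of the quotient on the unit ball. Its supremum over \<open>e\<close> is the least candidate for
  \<open>u r\<close>.
\<close>

definition quotient_deficit ::
    "('w \<Rightarrow> 'e \<Rightarrow> ereal) \<Rightarrow> ('w \<Rightarrow> ('e::real_normed_vector \<Rightarrow>\<^sub>L real)) \<Rightarrow> ('w \<Rightarrow> 'e) \<Rightarrow>
     real \<Rightarrow> 'w \<Rightarrow> 'e \<Rightarrow> ennreal" where
  "quotient_deficit f xs x0 r \<omega> e =
     (if norm e \<le> 1 then e2ennreal (- reduced_quotient f xs x0 e r \<omega>) else 0)"

lemma measurable_quotient_deficit:
  fixes f :: "'w \<Rightarrow> 'e::{banach, second_countable_topology} \<Rightarrow> ereal"
  assumes "(\<lambda>(\<omega>, x). f \<omega> x) \<in> borel_measurable (M \<Otimes>\<^sub>M borel)"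
    and "x0 \<in> borel_measurable M"
    and "\<And>e. (\<lambda>\<omega>. blinfun_apply (xs \<omega>) e) \<in> borel_measurable M"
  shows "(\<lambda>(\<omega>, e). quotient_deficit f xs x0 r \<omega> e) \<in> borel_measurable (M \<Otimes>\<^sub>M borel)"
proof -
  have [measurable]: "(\<lambda>p. reduced_quotient f xs x0 (snd p) r (fst p)) \<in> borel_measurable (M \<Otimes>\<^sub>M borel)"
    using measurable_reduced_quotient[OF assms] by (simp add: case_prod_beta)
  show ?thesis
    unfolding quotient_deficit_def case_prod_beta by measurable
qed

text \<open>
  Where the deficit is positive, the quotient may still be \<open>-\<infinity>\<close> but not \<open>\<infinity>\<close>, so \<open>f\<close> can be recovered
  from the deficit.
\<close>

lemma quotient_deficit_eq:
  assumes "f \<omega> (x0 \<omega>) = ereal g" "r > 0" "quotient_deficit f xs x0 r \<omega> e \<noteq> 0"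
  shows "norm e \<le> 1"
    "f \<omega> (x0 \<omega> + r *\<^sub>R e) =
      ereal (g + r * blinfun_apply (xs \<omega>) e) - enn2ereal (ennreal r * quotient_deficit f xs x0 r \<omega> e)"
proof -
  show 1: "norm e \<le> 1"
    using assms(3) by (auto simp: quotient_deficit_def split: if_splits)
  let ?q = "reduced_quotient f xs x0 e r \<omega>"
  have d: "quotient_deficit f xs x0 r \<omega> e = e2ennreal (- ?q)"
    using 1 by (simp add: quotient_deficit_def)
  have "0 \<le> - ?q"
    using assms(3) unfolding d by (metis e2ennreal_neg nle_le)
  then have "enn2ereal (ennreal r * quotient_deficit f xs x0 r \<omega> e) = ereal r * - ?q"
    using assms(2) unfolding d by (simp add: times_ennreal.rep_eq enn2ereal_e2ennreal enn2ereal_ennreal)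
  with \<open>0 \<le> - ?q\<close> show "f \<omega> (x0 \<omega> + r *\<^sub>R e) =
      ereal (g + r * blinfun_apply (xs \<omega>) e) - enn2ereal (ennreal r * quotient_deficit f xs x0 r \<omega> e)"
    using assms(1,2) by (cases "f \<omega> (x0 \<omega> + r *\<^sub>R e)") (auto simp: reduced_quotient_def field_simps)
qed

lemma quotient_deficit_le_imp:
  assumes "quotient_deficit f xs x0 r \<omega> e \<le> ennreal u" "0 \<le> u" "norm e \<le> 1"
  shows "- ereal u \<le> reduced_quotient f xs x0 e r \<omega>"
proof (cases "0 \<le> reduced_quotient f xs x0 e r \<omega>")
  case True
  have "- ereal u \<le> 0"
    using assms(2) by simp
  with True show ?thesis
    by (rule order_trans[rotated])
next
  case False
  then have "enn2ereal (e2ennreal (- reduced_quotient f xs x0 e r \<omega>)) = - reduced_quotient f xs x0 e r \<omega>"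
    by (intro enn2ereal_e2ennreal) (simp add: ereal_uminus_le_reorder)
  moreover have "enn2ereal (e2ennreal (- reduced_quotient f xs x0 e r \<omega>)) \<le> enn2ereal (ennreal u)"
    using assms(1,3) by (simp add: quotient_deficit_def less_eq_ennreal.rep_eq)
  ultimately show ?thesis
    using assms(2) by (simp add: enn2ereal_ennreal ereal_uminus_le_reorder)
qed

text \<open>
  The subderivative inequality is tested on \<open>x0 + r y\<close>, where \<open>y\<close> is first set to \<open>0\<close> at the points
  with zero deficit. This step changes no deficit, it brings \<open>y\<close> into the unit ball, and it makes the
  increment of \<open>f\<close> minus its linear part equal to \<open>-r\<close> times the deficit almost everywhere.
\<close>

lemma nn_integral_quotient_deficit_le:
  fixes f :: "'w \<Rightarrow> 'e::{banach, second_countable_topology} \<Rightarrow> ereal"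
  assumes M: "sigma_finite_measure M"
    and f: "(\<lambda>(\<omega>, x). f \<omega> x) \<in> borel_measurable (M \<Otimes>\<^sub>M borel)"
    and x0: "x0 \<in> Linf M" and xs: "xs \<in> L1_dual M"
    and g: "integrable M g" "AE \<omega> in M. f \<omega> (x0 \<omega>) = ereal (g \<omega>)"
    and lower: "\<And>x. x \<in> Linf M \<Longrightarrow> 0 < Linf_norm M (x - x0) \<Longrightarrow> Linf_norm M (x - x0) \<le> r \<Longrightarrow>
      ereal ((\<integral>\<omega>. g \<omega> \<partial>M) + pairing M xs (x - x0) - \<epsilon> * Linf_norm M (x - x0)) \<le> integral_functional M f x"
    and "0 < r" "0 \<le> \<epsilon>" and y: "y \<in> borel_measurable M"
  shows "(\<integral>\<^sup>+\<omega>. quotient_deficit f xs x0 r \<omega> (y \<omega>) \<partial>M) \<le> ennreal \<epsilon>"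
proof -
  interpret sigma_finite_measure M by (rule M)
  define j where "j = (\<integral>\<omega>. g \<omega> \<partial>M)"
  define k where "k \<omega> = quotient_deficit f xs x0 r \<omega> (y \<omega>)" for \<omega>
  have mx0[measurable]: "x0 \<in> borel_measurable M"
    using x0 by (simp add: Linf_def)
  have mk[measurable]: "k \<in> borel_measurable M"
    unfolding k_def using xs y
      measurable_compose[OF _ measurable_quotient_deficit[OF f mx0, of xs r], of "\<lambda>\<omega>. (\<omega>, y \<omega>)" M]
    by (simp add: L1_dual_def)
  define z where "z \<omega> = (if k \<omega> = 0 then 0 else r *\<^sub>R y \<omega>)" for \<omega>
  have mz[measurable]: "z \<in> borel_measurable M"
    unfolding z_def using y by measurable
  define x where "x \<omega> = x0 \<omega> + z \<omega>" for \<omega>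
  have xz: "x - x0 = z"
    by (simp add: x_def fun_eq_iff)
  have z_le: "AE \<omega> in M. norm (z \<omega>) \<le> r"
    using g(2)
  proof eventually_elim
    case (elim \<omega>)
    show ?case
      using quotient_deficit_eq(1)[where f = f and \<omega> = \<omega> and ?x0.0 = x0 and xs = xs and e = "y \<omega>", OF elim \<open>0 < r\<close>] \<open>0 < r\<close>
      by (auto simp: z_def k_def mult_left_le)
  qed
  have z: "z \<in> Linf M" "Linf_norm M z \<le> r"
    using Linf_AE_boundedI[OF mz z_le] \<open>0 < r\<close> by auto
  have x: "x \<in> Linf M"
  proof (rule Linf_AE_boundedI(1))
    show "x \<in> borel_measurable M"
      unfolding x_def by measurable
    show "AE \<omega> in M. norm (x \<omega>) \<le> max 0 (Linf_norm M x0 + r)"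
      using AE_norm_le_Linf_norm[OF x0] z_le
    proof eventually_elim
      case (elim \<omega>)
      then show ?case
        using norm_triangle_ineq[of "x0 \<omega>" "z \<omega>"] by (simp add: x_def)
    qed
  qed simp
  define a where "a \<omega> = g \<omega> + blinfun_apply (xs \<omega>) (z \<omega>)" for \<omega>
  have iz: "integrable M (\<lambda>\<omega>. blinfun_apply (xs \<omega>) (z \<omega>))"
    by (rule integrable_L1_dual_apply[OF xs mz z_le])
  have ia: "integrable M a"
    unfolding a_def using g(1) iz by auto
  have a: "(\<integral>\<omega>. a \<omega> \<partial>M) = j + pairing M xs z"
    unfolding a_def pairing_def j_def using g(1) iz by simp
  have fx: "AE \<omega> in M. f \<omega> (x \<omega>) = ereal (a \<omega>) - enn2ereal (ennreal r * k \<omega>)"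
    using g(2)
  proof eventually_elim
    case (elim \<omega>)
    show ?case
      using quotient_deficit_eq(2)[where f = f and \<omega> = \<omega> and ?x0.0 = x0 and xs = xs and e = "y \<omega>", OF elim \<open>0 < r\<close>] elim
      by (cases "k \<omega> = 0") (simp_all add: x_def z_def a_def k_def blinfun.scaleR_right zero_ennreal.rep_eq)
  qed
  \<comment> \<open>The subderivative inequality says nothing at distance zero from \<open>x0\<close>; there \<open>x\<close> equals \<open>x0\<close>
    almost everywhere.\<close>
  have "ereal (j + pairing M xs z - \<epsilon> * r) \<le> integral_functional M f x"
  proof (cases "0 < Linf_norm M z")
    case True
    have "\<epsilon> * Linf_norm M z \<le> \<epsilon> * r"
      using z(2) \<open>0 \<le> \<epsilon>\<close> by (rule mult_left_mono)
    then have "ereal (j + pairing M xs z - \<epsilon> * r) \<le> ereal (j + pairing M xs z - \<epsilon> * Linf_norm M z)"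
      by simp
    also have "\<dots> \<le> integral_functional M f x"
      using lower[OF x] True z(2) by (simp add: xz j_def)
    finally show ?thesis .
  next
    case False
    have z0: "AE \<omega> in M. z \<omega> = 0"
      using AE_norm_le_Linf_norm[OF z(1)]
    proof eventually_elim
      case (elim \<omega>)
      with False have "norm (z \<omega>) \<le> 0"
        by linarith
      then show ?case
        by simp
    qed
    then have "AE \<omega> in M. blinfun_apply (xs \<omega>) (z \<omega>) = 0"
      by eventually_elim (simp add: blinfun.zero_right)
    then have "pairing M xs z = 0"
      unfolding pairing_def by (rule integral_eq_zero_AE)
    moreover have "integral_functional M f x = ereal j"
      unfolding integral_functional_def j_def using g(2) z0
      by (intro upper_integral_eq_integral[OF g(1)]) (auto elim!: eventually_elim2 simp: x_def)
    ultimately show ?thesis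
      using \<open>0 < r\<close> \<open>0 \<le> \<epsilon>\<close> by simp
  qed
  then have "ereal (j + pairing M xs z - \<epsilon> * r) \<le> upper_integral M (\<lambda>\<omega>. f \<omega> (x \<omega>))"
    by (simp add: integral_functional_def)
  moreover have "AE \<omega> in M. f \<omega> (x \<omega>) \<le> ereal (a \<omega>) - enn2ereal (ennreal r * k \<omega>)"
    using fx by eventually_elim simp
  ultimately have "(\<integral>\<^sup>+\<omega>. ennreal r * k \<omega> \<partial>M) \<le> ennreal (\<epsilon> * r)"
    using nn_integral_le_of_upper_integral_ge[OF ia, of "\<lambda>\<omega>. ennreal r * k \<omega>" "\<lambda>\<omega>. f \<omega> (x \<omega>)"
      "j + pairing M xs z - \<epsilon> * r"] a
    by simp
  then have "ennreal r * (\<integral>\<^sup>+\<omega>. k \<omega> \<partial>M) \<le> ennreal r * ennreal \<epsilon>"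
    using \<open>0 < r\<close> \<open>0 \<le> \<epsilon>\<close> by (simp add: nn_integral_cmult ennreal_mult' mult.commute)
  then show ?thesis
    using \<open>0 < r\<close> unfolding k_def by (simp add: ennreal_mult_le_mult_iff)
qed

text \<open>
  The deficits of all measurable selections have integral at most \<open>\<epsilon>\<close> for small \<open>r\<close>. Interchanging
  integral and supremum gives a function above the deficit at every \<open>e\<close> simultaneously whose integral is
  still at most \<open>\<epsilon>\<close>.
\<close>

lemma quotient_bound_if_frechet_subderivative:
  fixes f :: "'w \<Rightarrow> 'e::{banach, second_countable_topology} \<Rightarrow> ereal"
  assumes M: "sigma_finite_measure M"
    and f: "(\<lambda>(\<omega>, x). f \<omega> x) \<in> borel_measurable (M \<Otimes>\<^sub>M borel)"
    and x0: "x0 \<in> Linf M" and xs: "xs \<in> L1_dual M"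
    and g: "integrable M g" "AE \<omega> in M. f \<omega> (x0 \<omega>) = ereal (g \<omega>)"
    and sub: "frechet_subderivative (Linf M) (Linf_norm M) (integral_functional M f) (pairing M xs) x0"
  obtains u :: "real \<Rightarrow> 'w \<Rightarrow> real" where
    "\<And>r \<omega>. 0 \<le> u r \<omega>" "\<forall>\<^sub>F r in at_right 0. integrable M (u r)"
    "((\<lambda>r. \<integral>\<omega>. \<bar>u r \<omega>\<bar> \<partial>M) \<longlongrightarrow> 0) (at_right 0)"
    "\<forall>\<^sub>F r in at_right 0. AE \<omega> in M.
        (INF e\<in>cball 0 1. reduced_quotient f xs x0 e r \<omega>) \<ge> - ereal (u r \<omega>)"
proof -
  interpret sigma_finite_measure M by (rule M)
  let ?d = "quotient_deficit f xs x0"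
  have J: "integral_functional M f x0 = ereal (\<integral>\<omega>. g \<omega> \<partial>M)"
    unfolding integral_functional_def by (rule upper_integral_eq_integral[OF g])
  have md: "(\<lambda>(\<omega>, e). ?d r \<omega> e) \<in> borel_measurable (M \<Otimes>\<^sub>M borel)" for r
    using x0 xs by (intro measurable_quotient_deficit[OF f]) (auto simp: Linf_def L1_dual_def)
  have "\<forall>r. \<exists>U. U \<in> borel_measurable M \<and> (AE \<omega> in M. \<forall>e. ?d r \<omega> e \<le> U \<omega>) \<and>
    (\<integral>\<^sup>+\<omega>. U \<omega> \<partial>M) = (SUP y\<in>borel_measurable M. \<integral>\<^sup>+\<omega>. ?d r \<omega> (y \<omega>) \<partial>M)"
    using nn_integral_sup_selections[OF md] by blast
  from choice[OF this] obtain U where U':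
    "\<forall>r. U r \<in> borel_measurable M \<and> (AE \<omega> in M. \<forall>e. ?d r \<omega> e \<le> U r \<omega>) \<and>
      (\<integral>\<^sup>+\<omega>. U r \<omega> \<partial>M) = (SUP y\<in>borel_measurable M. \<integral>\<^sup>+\<omega>. ?d r \<omega> (y \<omega>) \<partial>M)"
    by (rule exE)
  have U: "U r \<in> borel_measurable M" "AE \<omega> in M. \<forall>e. ?d r \<omega> e \<le> U r \<omega>"
    "(\<integral>\<^sup>+\<omega>. U r \<omega> \<partial>M) = (SUP y\<in>borel_measurable M. \<integral>\<^sup>+\<omega>. ?d r \<omega> (y \<omega>) \<partial>M)" for r
    using U'[rule_format, of r] by simp_all
  have small: "\<forall>\<^sub>F r in at_right 0. 0 < r \<and> (\<integral>\<^sup>+\<omega>. U r \<omega> \<partial>M) \<le> ennreal \<epsilon>" if "\<epsilon> > 0" for \<epsilon>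
  proof -
    have "\<exists>\<delta>>0. \<forall>x\<in>Linf M. 0 < Linf_norm M (x - x0) \<and> Linf_norm M (x - x0) < \<delta> \<longrightarrow>
        ereal ((\<integral>\<omega>. g \<omega> \<partial>M) + pairing M xs (x - x0) - \<epsilon> * Linf_norm M (x - x0)) \<le> integral_functional M f x"
      using frechet_subderivative_iff[THEN iffD1, of "integral_functional M f", OF J sub] that by simp
    then obtain \<delta> where "\<delta> > 0" and \<delta>: "\<forall>x\<in>Linf M. 0 < Linf_norm M (x - x0) \<and> Linf_norm M (x - x0) < \<delta> \<longrightarrow>
        ereal ((\<integral>\<omega>. g \<omega> \<partial>M) + pairing M xs (x - x0) - \<epsilon> * Linf_norm M (x - x0)) \<le> integral_functional M f x"
      by (elim exE conjE)
    have "(\<integral>\<^sup>+\<omega>. U r \<omega> \<partial>M) \<le> ennreal \<epsilon>" if r: "0 < r" "r < \<delta>" for r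
      unfolding U(3)
    proof (rule SUP_least)
      fix y :: "'w \<Rightarrow> 'e" assume y: "y \<in> borel_measurable M"
      show "(\<integral>\<^sup>+\<omega>. ?d r \<omega> (y \<omega>) \<partial>M) \<le> ennreal \<epsilon>"
      proof (rule nn_integral_quotient_deficit_le[OF M f x0 xs g _ r(1) _ y])
        fix x assume "x \<in> Linf M" "0 < Linf_norm M (x - x0)" "Linf_norm M (x - x0) \<le> r"
        then show "ereal ((\<integral>\<omega>. g \<omega> \<partial>M) + pairing M xs (x - x0) - \<epsilon> * Linf_norm M (x - x0))
            \<le> integral_functional M f x"
          using r(2) by (intro \<delta>[rule_format]) simp_all
      qed (use \<open>\<epsilon> > 0\<close> in simp)
    qed
    with \<open>\<delta> > 0\<close> show ?thesis
      unfolding eventually_at_right_field by blast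
  qed
  define u where "u r \<omega> = enn2real (U r \<omega>)" for r \<omega>
  have u_nonneg: "0 \<le> u r \<omega>" for r \<omega>
    by (simp add: u_def)
  have u_eq: "AE \<omega> in M. ennreal (u r \<omega>) = U r \<omega>" if "(\<integral>\<^sup>+\<omega>. U r \<omega> \<partial>M) < \<infinity>" for r
  proof -
    have "AE \<omega> in M. U r \<omega> \<noteq> \<infinity>"
      using that by (intro nn_integral_PInf_AE U(1)) auto
    then show ?thesis
      by eventually_elim (auto simp: u_def less_top)
  qed
  have mu: "u r \<in> borel_measurable M" for r
    unfolding u_def using U(1) by measurable
  have iu: "integrable M (u r)" if "(\<integral>\<^sup>+\<omega>. U r \<omega> \<partial>M) < \<infinity>" for r
  proof (rule integrableI_nonneg[OF mu])
    show "AE \<omega> in M. 0 \<le> u r \<omega>"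
      by (simp add: u_def)
    show "(\<integral>\<^sup>+\<omega>. ennreal (u r \<omega>) \<partial>M) < \<infinity>"
      using nn_integral_cong_AE[OF u_eq[OF that]] that by simp
  qed
  have fin: "\<forall>\<^sub>F r in at_right 0. (\<integral>\<^sup>+\<omega>. U r \<omega> \<partial>M) < \<infinity>"
    using small[OF zero_less_one] by eventually_elim (auto intro: order_le_less_trans)
  have lim: "((\<lambda>r. \<integral>\<omega>. \<bar>u r \<omega>\<bar> \<partial>M) \<longlongrightarrow> 0) (at_right 0)"
  proof (rule tendstoI)
    fix \<epsilon> :: real assume "\<epsilon> > 0"
    then have "\<forall>\<^sub>F r in at_right 0. 0 < r \<and> (\<integral>\<^sup>+\<omega>. U r \<omega> \<partial>M) \<le> ennreal (\<epsilon> / 2)"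
      by (intro small) simp
    with fin show "\<forall>\<^sub>F r in at_right 0. dist (\<integral>\<omega>. \<bar>u r \<omega>\<bar> \<partial>M) 0 < \<epsilon>"
    proof eventually_elim
      case (elim r)
      have "ennreal (\<integral>\<omega>. u r \<omega> \<partial>M) = (\<integral>\<^sup>+\<omega>. ennreal (u r \<omega>) \<partial>M)"
        using nn_integral_eq_integral[OF iu[OF elim(1)]] u_nonneg by simp
      also have "\<dots> \<le> ennreal (\<epsilon> / 2)"
        using nn_integral_cong_AE[OF u_eq[OF elim(1)]] elim(2) by simp
      finally have "(\<integral>\<omega>. u r \<omega> \<partial>M) \<le> \<epsilon> / 2"
        using \<open>\<epsilon> > 0\<close> by (simp add: ennreal_le_iff)
      moreover have "0 \<le> (\<integral>\<omega>. u r \<omega> \<partial>M)"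
        using u_nonneg by (intro integral_nonneg_AE) simp
      ultimately show ?case
        using \<open>\<epsilon> > 0\<close> u_nonneg by simp
    qed
  qed
  have bound: "\<forall>\<^sub>F r in at_right 0. AE \<omega> in M.
      (INF e\<in>cball 0 1. reduced_quotient f xs x0 e r \<omega>) \<ge> - ereal (u r \<omega>)"
    using fin
  proof eventually_elim
    case (elim r)
    show ?case
      using U(2)[of r] u_eq[OF elim]
    proof eventually_elim
      case (elim \<omega>)
      show ?case
      proof (rule INF_greatest)
        fix e :: 'e assume "e \<in> cball 0 1"
        then show "- ereal (u r \<omega>) \<le> reduced_quotient f xs x0 e r \<omega>"
          using elim by (intro quotient_deficit_le_imp[of f]) (auto simp: u_nonneg)
      qed
    qed
  qed
  have "\<forall>\<^sub>F r in at_right 0. integrable M (u r)"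
    using fin by eventually_elim (rule iu)
  then show thesis
    using lim bound by (intro that[of u] u_nonneg)
qed

theorem corollary9p8:
  fixes M :: "'w measure"
    and f :: "'w \<Rightarrow> 'e::{banach, second_countable_topology} \<Rightarrow> ereal"
    and x0 :: "'w \<Rightarrow> 'e"
    and xs :: "'w \<Rightarrow> ('e \<Rightarrow>\<^sub>L real)"
  assumes "sigma_finite_measure M"
    and "complete_measure M"
    and "normal_integrand M f"
    and "x0 \<in> Linf M"
    and "\<bar>integral_functional M f x0\<bar> \<noteq> \<infinity>"
    and "xs \<in> L1_dual M"
  shows "frechet_subderivative (Linf M) (Linf_norm M) (integral_functional M f) (pairing M xs) x0
    \<longleftrightarrow>
    (\<exists>u :: real \<Rightarrow> 'w \<Rightarrow> real.
       (\<forall>\<^sub>F r in at_right 0. integrable M (u r) \<and> (\<forall>\<omega>\<in>space M. 0 \<le> u r \<omega>)) \<and>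
       ((\<lambda>r. \<integral>\<omega>. \<bar>u r \<omega>\<bar> \<partial>M) \<longlongrightarrow> 0) (at_right 0) \<and>
       (\<forall>\<^sub>F r in at_right 0. AE \<omega> in M.
          (INF e\<in>cball 0 1. reduced_quotient f xs x0 e r \<omega>) \<ge> - ereal (u r \<omega>)))"
proof -
  interpret sigma_finite_measure M by (rule assms(1))
  have f: "(\<lambda>(\<omega>, x). f \<omega> x) \<in> borel_measurable (M \<Otimes>\<^sub>M borel)"
    using assms(3) by (simp add: normal_integrand_def)
  have "x0 \<in> borel_measurable M"
    using assms(4) by (simp add: Linf_def)
  then have "(\<lambda>\<omega>. f \<omega> (x0 \<omega>)) \<in> borel_measurable M"
    using measurable_compose[OF _ f, of "\<lambda>\<omega>. (\<omega>, x0 \<omega>)" M] by simp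
  from finite_upper_integral_imp_integrable[OF this] assms(5)
  obtain g where g: "integrable M g" "AE \<omega> in M. f \<omega> (x0 \<omega>) = ereal (g \<omega>)"
    unfolding integral_functional_def by metis
  show ?thesis (is "?F \<longleftrightarrow> (\<exists>u. ?P u)")
  proof
    assume ?F
    then obtain u :: "real \<Rightarrow> 'w \<Rightarrow> real" where
      "\<And>r \<omega>. 0 \<le> u r \<omega>" "\<forall>\<^sub>F r in at_right 0. integrable M (u r)"
      "((\<lambda>r. \<integral>\<omega>. \<bar>u r \<omega>\<bar> \<partial>M) \<longlongrightarrow> 0) (at_right 0)"
      "\<forall>\<^sub>F r in at_right 0. AE \<omega> in M.
        (INF e\<in>cball 0 1. reduced_quotient f xs x0 e r \<omega>) \<ge> - ereal (u r \<omega>)"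
      by (rule quotient_bound_if_frechet_subderivative[OF assms(1) f assms(4,6) g]) (rule that)
    then show "\<exists>u. ?P u"
      by (intro exI[of _ u]) auto
  next
    assume "\<exists>u. ?P u"
    then show ?F
      using frechet_subderivative_if_quotient_bound[of x0 M xs g f, OF assms(4,6) g] by blast
  qed
qed

end
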